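(* Let $A_1,\ldots,A_t\subseteq\{2,\ldots,n\}$ be pairwise disjoint subsets and let $c_1,\ldots,c_t\ge 0$ be non-negative real numbers. Then the following inequality of operators holds in $\mathbb{R}[\mathrm{Sym}_n]$: $$\Big(\sum_{i=1}^{t}c_i|A_i|\Big)\Big(\sum_{j=1}^{t}c_j\big(\alpha_{A_j\cup\{1\}}-\alpha_{A_j}\big)\Big)\ \ge\ \sum_{i=1}^{t}c_i^{2}\,\alpha_{A_i}+\sum_{1\le i<j\le t}c_ic_j\big(\alpha_{A_i\cup A_j}-\alpha_{A_i}-\alpha_{A_j}\big).$$
   Context: $\mathrm{Sym}_n$ is the symmetric group on $[n]=\{1,\ldots,n\}$. For $\emptyset\ne A\subseteq[n]$, $$\alpha_A=\frac{1}{(|A|-1)!}\sum_{\pi\in\mathrm{Sym}(A)}(\mathrm{id}-\pi)\in\mathbb{R}[\mathrm{Sym}_n],$$ where $\mathrm{Sym}(A)\subseteq\mathrm{Sym}_n$ is the subgroup of permutations fixing every element outside $A$; and $\alpha_\emptyset=0$. For $\Sigma_1,\Sigma_2\in\mathbb{R}[\mathrm{Sym}_n]$, the inequality of operators $\Sigma_1\ge\Sigma_2$ means that $\Sigma_1-\Sigma_2$ acts as a positive semi-definite (self-adjoint with non-negative eigenvalues) operator in every finite-dimensional representation of $\mathrm{Sym}_n$ (with respect to a $\mathrm{Sym}_n$-invariant inner product); equivalently, it acts as a positive semi-definite operator by left multiplication on the regular representation $\mathbb{R}[\mathrm{Sym}_n]$, equipped with the inner product for which the group elements are orthonormal. *)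

theory Defs
  imports "HOL-Combinatorics.Permutations" "HOL-Library.Disjoint_Sets"
    "Jordan_Normal_Form.Char_Poly"
begin

text \<open>
  An element of \<open>\<real>[Sym\<^sub>n]\<close> is represented by its coefficient function
  \<open>(nat \<Rightarrow> nat) \<Rightarrow> real\<close>; only its values on permutations of \<open>{1..n}\<close> matter. The vector
  space operations are pointwise. A permutation in \<open>Sym(A)\<close> is a bijection of \<open>nat\<close>
  fixing every point outside \<open>A\<close>, so that \<open>Sym(A) \<subseteq> Sym\<^sub>n\<close> literally for \<open>A \<subseteq> {1..n}\<close>.
\<close>

type_synonym perm_coeffs = "(nat \<Rightarrow> nat) \<Rightarrow> real"

definition basis_elt :: "(nat \<Rightarrow> nat) \<Rightarrow> perm_coeffs" where
  "basis_elt \<pi> = (\<lambda>\<tau>. if \<tau> = \<pi> then 1 else 0)"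

definition alpha :: "nat set \<Rightarrow> perm_coeffs" where
  "alpha A = (\<lambda>\<tau>. if A = {} then 0 else
     1 / fact (card A - 1) * (\<Sum>\<pi> | \<pi> permutes A. basis_elt id \<tau> - basis_elt \<pi> \<tau>))"

text \<open>
  Choosing a basis, a \<open>d\<close>-dimensional representation is a homomorphism into \<open>d \<times> d\<close>
  matrices. We work over the complex numbers. This covers real orthogonal representations
  too: complexifying one preserves self-adjointness and the eigenvalues of the operators.
\<close>

definition sym_rep :: "nat \<Rightarrow> nat \<Rightarrow> ((nat \<Rightarrow> nat) \<Rightarrow> complex mat) \<Rightarrow> bool" where
  "sym_rep n d \<rho> \<longleftrightarrow>
     (\<forall>\<pi>. \<pi> permutes {1..n} \<longrightarrow> \<rho> \<pi> \<in> carrier_mat d d) \<and>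
     \<rho> id = 1\<^sub>m d \<and>
     (\<forall>\<pi> \<sigma>. \<pi> permutes {1..n} \<longrightarrow> \<sigma> permutes {1..n} \<longrightarrow> \<rho> (\<pi> \<circ> \<sigma>) = \<rho> \<pi> * \<rho> \<sigma>)"

definition inner_product_on :: "nat \<Rightarrow> (complex vec \<Rightarrow> complex vec \<Rightarrow> complex) \<Rightarrow> bool" where
  "inner_product_on d ip \<longleftrightarrow>
     (\<forall>u\<in>carrier_vec d. \<forall>v\<in>carrier_vec d. \<forall>w\<in>carrier_vec d. ip (u + v) w = ip u w + ip v w) \<and>
     (\<forall>a. \<forall>v\<in>carrier_vec d. \<forall>w\<in>carrier_vec d. ip (a \<cdot>\<^sub>v v) w = a * ip v w) \<and>
     (\<forall>v\<in>carrier_vec d. \<forall>w\<in>carrier_vec d. ip w v = cnj (ip v w)) \<and>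
     (\<forall>v\<in>carrier_vec d. v \<noteq> 0\<^sub>v d \<longrightarrow> 0 < Re (ip v v))"

definition sym_invariant ::
  "nat \<Rightarrow> nat \<Rightarrow> ((nat \<Rightarrow> nat) \<Rightarrow> complex mat) \<Rightarrow> (complex vec \<Rightarrow> complex vec \<Rightarrow> complex) \<Rightarrow> bool" where
  "sym_invariant n d \<rho> ip \<longleftrightarrow>
     (\<forall>\<pi>. \<pi> permutes {1..n} \<longrightarrow>
       (\<forall>v\<in>carrier_vec d. \<forall>w\<in>carrier_vec d. ip (\<rho> \<pi> *\<^sub>v v) (\<rho> \<pi> *\<^sub>v w) = ip v w))"

text \<open>The operator \<open>\<Sum>\<^sub>\<pi> f(\<pi>) \<rho>(\<pi>)\<close>, summed entrywise.\<close>

definition rep_action ::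
  "nat \<Rightarrow> nat \<Rightarrow> ((nat \<Rightarrow> nat) \<Rightarrow> complex mat) \<Rightarrow> perm_coeffs \<Rightarrow> complex mat" where
  "rep_action n d \<rho> f =
     mat d d (\<lambda>(i, j). \<Sum>\<pi> | \<pi> permutes {1..n}. complex_of_real (f \<pi>) * \<rho> \<pi> $$ (i, j))"

definition psd_operator ::
  "nat \<Rightarrow> (complex vec \<Rightarrow> complex vec \<Rightarrow> complex) \<Rightarrow> complex mat \<Rightarrow> bool" where
  "psd_operator d ip M \<longleftrightarrow>
     (\<forall>v\<in>carrier_vec d. \<forall>w\<in>carrier_vec d. ip (M *\<^sub>v v) w = ip v (M *\<^sub>v w)) \<and>
     (\<forall>k. eigenvalue M k \<longrightarrow> k \<in> \<real> \<and> 0 \<le> Re k)"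

definition op_geq :: "nat \<Rightarrow> perm_coeffs \<Rightarrow> perm_coeffs \<Rightarrow> bool" where
  "op_geq n f g \<longleftrightarrow>
     (\<forall>d \<rho> ip. sym_rep n d \<rho> \<longrightarrow> inner_product_on d ip \<longrightarrow> sym_invariant n d \<rho> ip \<longrightarrow>
        psd_operator d ip (rep_action n d \<rho> (\<lambda>\<pi>. f \<pi> - g \<pi>)))"

end

theory Submission
  imports Defs "HOL-Library.Poly_Mapping"
begin

text \<open>
  Let \<open>e\<^sub>A\<close> be the average of the elements of \<open>Sym(A)\<close>. It is a self-adjoint idempotent, and
  \<open>\<alpha>\<^sub>A = |A| (1 - e\<^sub>A)\<close>. Positivity is established inside the group algebra: an element that is a sum
  of squares \<open>g\<^sup>* g\<close> acts as a positive semi-definite operator in every unitary representation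
  (\<open>psd_operator_sos\<close>), and such sums form a cone closed under \<open>x \<mapsto> h x h\<^sup>*\<close>, which contains
  every self-adjoint idempotent. Three facts carry the proof.

  (1) The octopus inequality (\<open>octopus\<close>), which is the case of singletons \<open>A\<^sub>i\<close>. With
  weights \<open>x\<^sub>a \<ge> 0\<close> on the leaves and \<open>x\<^sub>z = - \<Sum>\<^sub>a x\<^sub>a\<close> at the root \<open>z\<close> (the point \<open>1\<close>), twice the
  difference of its two sides is
  \<open>M = \<Sum>\<^sub>i\<^sub>j x\<^sub>i x\<^sub>j (i j)\<close>, where \<open>i\<close> and \<open>j\<close> range over the leaves and the root and \<open>(i i) = 1\<close>.
  Put \<open>q = \<Sum>\<^sub>i x\<^sub>i\<^sup>2\<close>. Then \<open>2 q M = M\<^sup>2 + 4 \<Sum>\<^sub>J (- \<Prod>\<^sub>j\<^sub>\<in>\<^sub>J x\<^sub>j) P\<^sub>J\<close>, summed over the four-element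
  sets \<open>J\<close>, where \<open>P\<^sub>J\<close> is 12 times a projection: the average over the Klein group of \<open>J\<close> minus the
  average over the alternating group of \<open>J\<close>. So it is enough that the last sum is positive. Only the
  sets \<open>J\<close> that avoid \<open>z\<close> have a negative coefficient there, and replacing \<open>- x\<^sub>z\<close> by the sum of the
  leaf weights reduces the claim to five points: four of the \<open>P\<^sub>J\<close> dominate the fifth
  (\<open>sos_five_points\<close>). This holds because the sum \<open>F\<close> of all five satisfies \<open>F P\<^sub>J = 24 P\<^sub>J\<close>, so
  \<open>F - 2 P\<^sub>J\<close> is 24 times a projection.

  (2) The spectral gap of the complete graph (\<open>complete_graph_gap\<close>): the sum of \<open>1 - (a b)\<close> over the
  unordered pairs in \<open>A\<close> is at least \<open>\<alpha>\<^sub>A\<close>. Adding one point to \<open>A\<close> is controlled by the octopus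
  inequality with equal weights.

  (3) The averages \<open>e\<^sub>i\<close> of the blocks \<open>A\<^sub>i\<close> commute with each other and with all operators in
  question. Where all \<open>e\<^sub>i = 1\<close>, the desired inequality is the octopus inequality with weights constant
  on the blocks, followed by (2) on each \<open>A\<^sub>i \<union> A\<^sub>j\<close> (\<open>sos_sector\<close>). Where some \<open>e\<^sub>k = 0\<close>, block \<open>k\<close>
  drops out and induction on the number of blocks applies (\<open>sos_center_merge\<close>).
\<close>

section \<open>The real group algebra of a symmetric group\<close>

text \<open>
  The product of \<open>'a \<Rightarrow>\<^sub>0 'b\<close> is convolution over an additive key monoid. So the group of
  bijections is written additively, although it is not commutative.
\<close>

typedef 'a bijection = "{f :: 'a \<Rightarrow> 'a. bij f}"
  morphisms apply_bij Bij
  by (auto intro: bij_id)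

setup_lifting type_definition_bijection

instantiation bijection :: (type) group_add
begin

lift_definition zero_bijection :: "'a bijection" is id by (rule bij_id)

lift_definition plus_bijection :: "'a bijection \<Rightarrow> 'a bijection \<Rightarrow> 'a bijection"
  is "(\<circ>)" by (rule bij_comp)

lift_definition uminus_bijection :: "'a bijection \<Rightarrow> 'a bijection"
  is "inv_into UNIV" by (rule bij_imp_bij_inv)

definition minus_bijection :: "'a bijection \<Rightarrow> 'a bijection \<Rightarrow> 'a bijection"
  where "minus_bijection p q = p + - q"

instance
  by standard
    (unfold minus_bijection_def, (transfer, simp add: comp_assoc bij_is_inj)+)

end

instantiation poly_mapping :: (type, real_vector) real_vector
begin

lift_definition scaleR_poly_mapping :: "real \<Rightarrow> ('a \<Rightarrow>\<^sub>0 'b) \<Rightarrow> 'a \<Rightarrow>\<^sub>0 'b"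
  is "\<lambda>r f k. r *\<^sub>R f k"
  by (rule finite_subset[rotated], assumption) auto

instance
  by standard (transfer, simp add: fun_eq_iff scaleR_add_right scaleR_add_left)+

end

lemma lookup_scaleR: "Poly_Mapping.lookup (r *\<^sub>R f) k = r *\<^sub>R Poly_Mapping.lookup f k"
  by transfer simp

lemma scaleR_single: "r *\<^sub>R Poly_Mapping.single k v = Poly_Mapping.single k (r *\<^sub>R v)"
  by transfer (auto simp: fun_eq_iff when_def)

lemma poly_mapping_sum_single:
  "f = (\<Sum>k\<in>Poly_Mapping.keys f. Poly_Mapping.single k (Poly_Mapping.lookup f k))"
  by (intro poly_mapping_eqI)
    (simp add: lookup_sum lookup_single when_def in_keys_iff)

instance poly_mapping :: (monoid_add, real_algebra_1) real_algebra_1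
proof
  fix a :: real and x y :: "'a \<Rightarrow>\<^sub>0 'b"
  let ?S = "\<lambda>f. \<Sum>k\<in>Poly_Mapping.keys f. Poly_Mapping.single k (Poly_Mapping.lookup f k)"
  have "(a *\<^sub>R ?S x) * ?S y = a *\<^sub>R (?S x * ?S y)" "?S x * (a *\<^sub>R ?S y) = a *\<^sub>R (?S x * ?S y)"
    by (simp_all add: scaleR_sum_right sum_product scaleR_single mult_single)
  then show "(a *\<^sub>R x) * y = a *\<^sub>R (x * y)" "x * (a *\<^sub>R y) = a *\<^sub>R (x * y)"
    by (simp_all flip: poly_mapping_sum_single)
qed

type_synonym 'a group_algebra = "'a bijection \<Rightarrow>\<^sub>0 real"

definition perm_elt :: "('a \<Rightarrow> 'a) \<Rightarrow> 'a group_algebra" where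
  "perm_elt \<pi> = Poly_Mapping.single (Bij \<pi>) 1"

definition star :: "'a group_algebra \<Rightarrow> 'a group_algebra" where
  "star = Poly_Mapping.map_key uminus"

text \<open>
  The group algebra of \<open>Sym(N)\<close> inside that of all bijections. A representation of \<open>Sym(N)\<close> can act only on
  squares of elements of this subalgebra, hence positivity is defined relative to \<open>N\<close>.
\<close>

definition sym_alg :: "'a set \<Rightarrow> 'a group_algebra set" where
  "sym_alg N = {x. \<forall>p\<in>Poly_Mapping.keys x. apply_bij p permutes N}"

lemma perm_elt_id [simp]: "perm_elt id = 1"
  by (simp add: perm_elt_def flip: zero_bijection.abs_eq)

lemma lookup_perm_elt:
  "bij \<pi> \<Longrightarrow> bij \<tau> \<Longrightarrow> Poly_Mapping.lookup (perm_elt \<pi>) (Bij \<tau>) = (if \<tau> = \<pi> then 1 else 0)"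
  by (auto simp: perm_elt_def lookup_single when_def Bij_inject)

lemma perm_elt_mult:
  assumes "bij \<pi>" "bij \<sigma>"
  shows "perm_elt \<pi> * perm_elt \<sigma> = perm_elt (\<pi> \<circ> \<sigma>)"
  using assms by (simp add: perm_elt_def mult_single plus_bijection.abs_eq eq_onp_def)

lemma lookup_star: "Poly_Mapping.lookup (star x) p = Poly_Mapping.lookup x (- p)"
  by (simp add: star_def map_key.rep_eq)

lemma star_add: "star (x + y) = star x + star y"
  by (intro poly_mapping_eqI) (simp add: lookup_star lookup_add)

lemma star_minus: "star (x - y) = star x - star y"
  by (intro poly_mapping_eqI) (simp add: lookup_star lookup_minus)

lemma star_scaleR: "star (r *\<^sub>R x) = r *\<^sub>R star x"
  by (intro poly_mapping_eqI) (simp add: lookup_star lookup_scaleR)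

lemma star_zero: "star 0 = 0"
  by (intro poly_mapping_eqI) (simp add: lookup_star)

lemma star_sum: "star (\<Sum>i\<in>I. f i) = (\<Sum>i\<in>I. star (f i))"
  by (intro poly_mapping_eqI) (simp add: lookup_star lookup_sum)

lemma star_single: "star (Poly_Mapping.single p r) = Poly_Mapping.single (- p) r"
  by (intro poly_mapping_eqI) (auto simp add: lookup_star lookup_single when_def)

lemma star_perm_elt: "bij \<pi> \<Longrightarrow> star (perm_elt \<pi>) = perm_elt (inv_into UNIV \<pi>)"
  by (simp add: perm_elt_def star_single uminus_bijection.abs_eq eq_onp_def)

lemma star_one: "star 1 = 1"
  using star_perm_elt[OF bij_id] by simp

lemma star_star: "star (star x) = x"
  by (intro poly_mapping_eqI) (simp add: lookup_star)

lemma star_mult: "star (x * y) = star y * star x"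
proof -
  let ?S = "\<lambda>f. \<Sum>k\<in>Poly_Mapping.keys f. Poly_Mapping.single k (Poly_Mapping.lookup f k)"
  have "star (?S x * ?S y) = star (?S y) * star (?S x)"
    unfolding sum_product star_sum mult_single star_single
    by (subst sum.swap) (simp add: minus_add mult.commute)
  then show ?thesis by (simp flip: poly_mapping_sum_single)
qed

lemmas star_simps = star_add star_minus star_scaleR star_zero star_sum star_one star_mult star_star

lemma keys_scaleR_subset: "Poly_Mapping.keys (r *\<^sub>R f) \<subseteq> Poly_Mapping.keys f"
  by (auto simp: in_keys_iff lookup_scaleR)

lemma sym_alg_perm_elt: "\<pi> permutes N \<Longrightarrow> perm_elt \<pi> \<in> sym_alg N"
  by (simp add: sym_alg_def perm_elt_def Bij_inverse permutes_bij)

lemma sym_alg_zero: "0 \<in> sym_alg N"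
  by (simp add: sym_alg_def)

lemma sym_alg_one: "1 \<in> sym_alg N"
  using sym_alg_perm_elt[OF permutes_id] by simp

lemma sym_alg_add: "x \<in> sym_alg N \<Longrightarrow> y \<in> sym_alg N \<Longrightarrow> x + y \<in> sym_alg N"
  using keys_add[of x y] by (auto simp: sym_alg_def)

lemma sym_alg_scaleR: "x \<in> sym_alg N \<Longrightarrow> r *\<^sub>R x \<in> sym_alg N"
  using keys_scaleR_subset[of r x] by (auto simp: sym_alg_def)

lemma sym_alg_minus: "x \<in> sym_alg N \<Longrightarrow> y \<in> sym_alg N \<Longrightarrow> x - y \<in> sym_alg N"
  using sym_alg_add[of x N "(-1) *\<^sub>R y"] sym_alg_scaleR[of y N "-1"] by simp

lemma sym_alg_sum: "(\<And>i. i \<in> I \<Longrightarrow> f i \<in> sym_alg N) \<Longrightarrow> (\<Sum>i\<in>I. f i) \<in> sym_alg N"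
  by (induction I rule: infinite_finite_induct) (auto intro: sym_alg_zero sym_alg_add)

lemma sym_alg_mult: "x \<in> sym_alg N \<Longrightarrow> y \<in> sym_alg N \<Longrightarrow> x * y \<in> sym_alg N"
  using keys_mult[of x y]
  by (fastforce simp: sym_alg_def plus_bijection.rep_eq intro: permutes_compose)

lemma sym_alg_star: "x \<in> sym_alg N \<Longrightarrow> star x \<in> sym_alg N"
  unfolding sym_alg_def
proof safe
  fix p assume x: "\<forall>p\<in>Poly_Mapping.keys x. apply_bij p permutes N"
    and p: "p \<in> Poly_Mapping.keys (star x)"
  then have "apply_bij (- p) permutes N" by (simp add: in_keys_iff lookup_star)
  then have "inv_into UNIV (apply_bij (- p)) permutes N" by (rule permutes_inv)
  then show "apply_bij p permutes N"
    by (metis minus_minus uminus_bijection.rep_eq)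
qed

lemmas sym_alg_intros = sym_alg_zero sym_alg_one sym_alg_add sym_alg_scaleR sym_alg_minus
  sym_alg_sum sym_alg_mult sym_alg_star

section \<open>Sums of squares\<close>

inductive sos :: "'a set \<Rightarrow> 'a group_algebra \<Rightarrow> bool" for N where
  sos_zero: "sos N 0"
| sos_add_square: "sos N x \<Longrightarrow> g \<in> sym_alg N \<Longrightarrow> sos N (x + star g * g)"

lemma sos_square: "g \<in> sym_alg N \<Longrightarrow> sos N (star g * g)"
  using sos_add_square[OF sos_zero] by simp

lemma sos_add:
  assumes "sos N x" "sos N y"
  shows "sos N (x + y)"
  using assms(2)
proof induction
  case (sos_add_square y g)
  then show ?case using sos.sos_add_square[of N "x + y" g] by (simp add: add.assoc)
qed (use assms(1) in simp)

lemma sos_sum: "(\<And>i. i \<in> I \<Longrightarrow> sos N (f i)) \<Longrightarrow> sos N (\<Sum>i\<in>I. f i)"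
  by (induction I rule: infinite_finite_induct) (auto intro: sos_zero sos_add)

lemma sos_conj:
  assumes "sos N x" "h \<in> sym_alg N"
  shows "sos N (h * x * star h)"
  using assms(1)
proof induction
  case (sos_add_square x g)
  have "sos N (star (g * star h) * (g * star h))"
    using sos_add_square assms by (intro sos_square sym_alg_mult sym_alg_star)
  then show ?case
    using sos_add[OF sos_add_square.IH, of "star (g * star h) * (g * star h)"]
    by (simp add: distrib_left distrib_right star_simps mult.assoc)
qed (simp add: sos_zero)

lemma sos_scaleR:
  assumes "sos N x" "0 \<le> r"
  shows "sos N (r *\<^sub>R x)"
proof -
  have "sos N ((sqrt r *\<^sub>R 1) * x * star (sqrt r *\<^sub>R 1))"
    using assms by (intro sos_conj sym_alg_intros)
  then show ?thesis using assms(2) by (simp add: star_simps)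
qed

lemma sos_scaleR_iff: "0 < r \<Longrightarrow> sos N (r *\<^sub>R x) \<longleftrightarrow> sos N x"
  using sos_scaleR[of N "r *\<^sub>R x" "inverse r"] sos_scaleR[of N x r] by auto

lemma sos_star: "sos N x \<Longrightarrow> star x = x"
  by (induction rule: sos.induct) (simp_all add: star_simps)

text \<open>
  The criterion by which positive elements are recognised: a self-adjoint \<open>x\<close> with \<open>x\<^sup>2 = r x\<close> is itself
  the square \<open>x\<^sup>* x\<close> up to the factor \<open>r\<close>.
\<close>

lemma sos_scaled_projection:
  assumes "x \<in> sym_alg N" "star x = x" "x * x = r *\<^sub>R x" "0 < r"
  shows "sos N x"
  using sos_square[OF assms(1)] assms by (simp add: sos_scaleR_iff)

section \<open>Transpositions\<close>

definition tau :: "'a \<Rightarrow> 'a \<Rightarrow> 'a group_algebra" where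
  "tau i j = perm_elt (transpose i j)"

lemma tau_sym: "tau i j = tau j i"
  by (simp add: tau_def transpose_commute)

lemma tau_same [simp]: "tau i i = 1"
  by (simp add: tau_def)

lemma tau_square [simp]: "tau i j * tau i j = 1"
  by (simp add: tau_def perm_elt_mult)

lemma tau_cancel [simp]: "tau i j * (tau i j * x) = x"
  by (simp flip: mult.assoc)

lemma star_tau: "star (tau i j) = tau i j"
  by (simp add: tau_def star_perm_elt)

lemma sym_alg_tau: "i \<in> N \<Longrightarrow> j \<in> N \<Longrightarrow> tau i j \<in> sym_alg N"
  by (simp add: tau_def sym_alg_perm_elt permutes_swap_id)

lemma perm_elt_tau:
  assumes "bij \<pi>"
  shows "perm_elt \<pi> * tau i j = tau (\<pi> i) (\<pi> j) * perm_elt \<pi>"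
proof -
  have "\<pi> \<circ> transpose i j = transpose (\<pi> i) (\<pi> j) \<circ> \<pi>"
    using bij_is_inj[OF assms] by (auto simp: fun_eq_iff transpose_def inj_eq)
  then show ?thesis using assms by (simp add: tau_def perm_elt_mult)
qed

lemma tau_conj: "tau i j * tau k l = tau (transpose i j k) (transpose i j l) * tau i j"
  unfolding tau_def[of i j] by (intro perm_elt_tau) simp

text \<open>
  Conjugation by \<open>(i j)\<close>, in the form that matches the three factorisations of a 3-cycle into two
  transpositions.
\<close>

lemma tau_conj3: "i \<noteq> k \<Longrightarrow> j \<noteq> k \<Longrightarrow> tau i j * tau i k = tau j k * tau i j"
  by (subst tau_conj) simp

lemma tau_disjoint:
  "i \<noteq> k \<Longrightarrow> j \<noteq> k \<Longrightarrow> i \<noteq> l \<Longrightarrow> j \<noteq> l \<Longrightarrow> tau i j * tau k l = tau k l * tau i j"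
  by (subst tau_conj) simp

lemma tau_word_eqI:
  assumes "transpose a b \<circ> transpose c d \<circ> (transpose e f \<circ> transpose g h) = transpose p q \<circ> transpose r s"
  shows "(tau a b * tau c d) * (tau e f * tau g h) = tau p q * tau r s"
  using assms by (simp add: tau_def perm_elt_mult bij_comp)

section \<open>Four-element subsets and the two-dimensional representation\<close>

text \<open>
  The sum of the two 3-cycles on \<open>{i, j, k}\<close>.
\<close>

definition cyc :: "'a \<Rightarrow> 'a \<Rightarrow> 'a \<Rightarrow> 'a group_algebra" where
  "cyc i j k = tau i j * tau i k + tau i k * tau i j"

text \<open>
  Four times the average over the Klein four-group \<open>V\<close> of \<open>{i, j, k, l}\<close>.
\<close>

definition klein :: "'a \<Rightarrow> 'a \<Rightarrow> 'a \<Rightarrow> 'a \<Rightarrow> 'a group_algebra" where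
  "klein i j k l = 1 + tau i j * tau k l + tau i k * tau j l + tau i l * tau j k"

text \<open>
  Let \<open>V\<close> and \<open>Alt\<close> be the Klein and the alternating group of \<open>{i, j, k, l}\<close>. Since \<open>Alt\<close> is made of \<open>V\<close>
  and the eight 3-cycles, this is \<open>12 (e\<^sub>V - e\<^sub>A\<^sub>l\<^sub>t)\<close> for the averages \<open>e\<^sub>V\<close> and \<open>e\<^sub>A\<^sub>l\<^sub>t\<close>: twelve times the
  projection to the isotypic part of the two-dimensional irreducible representation of \<open>Sym(4)\<close>.
\<close>

definition four_point :: "'a \<Rightarrow> 'a \<Rightarrow> 'a \<Rightarrow> 'a \<Rightarrow> 'a group_algebra" where
  "four_point i j k l = klein i j k l + klein i j k l - (cyc i j k + cyc i j l + cyc i k l + cyc j k l)"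

lemma cyc_swap:
  assumes "distinct [i, j, k]"
  shows "cyc j i k = cyc i j k" "cyc i k j = cyc i j k"
proof -
  have "tau i j * tau j k = tau i k * tau i j" "tau j k * tau i j = tau i j * tau i k"
    using tau_conj3[of j k i] tau_conj3[of i k j] assms by (auto simp: tau_sym)
  then show "cyc j i k = cyc i j k" "cyc i k j = cyc i j k"
    by (simp_all add: cyc_def tau_sym[of j i] add.commute)
qed

lemma klein_swap:
  assumes "distinct [i, j, k, l]"
  shows "klein j i k l = klein i j k l" "klein i k j l = klein i j k l" "klein i j l k = klein i j k l"
proof -
  have "tau j k * tau i l = tau i l * tau j k" "tau j l * tau i k = tau i k * tau j l"
    using assms by (auto intro: tau_disjoint)
  then show "klein j i k l = klein i j k l" "klein i k j l = klein i j k l" "klein i j l k = klein i j k l"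
    by (simp_all add: klein_def tau_sym[of j i] tau_sym[of k j] tau_sym[of l k] add_ac)
qed

lemma four_point_swap:
  assumes "distinct [i, j, k, l]"
  shows "four_point j i k l = four_point i j k l" "four_point i k j l = four_point i j k l" "four_point i j l k = four_point i j k l"
  using assms cyc_swap[of i j k] cyc_swap[of i j l] cyc_swap[of i k l] cyc_swap[of j k l]
  by (simp_all add: four_point_def klein_swap[OF assms] add_ac)

text \<open>
  The eight 3-cycles are the two cosets of \<open>V\<close> in \<open>Alt\<close> other than \<open>V\<close>, represented by one 3-cycle and
  its inverse.
\<close>

lemma cyc_klein:
  assumes "distinct [i, j, k, l]"
  shows "cyc i j k * klein i j k l = cyc i j k + cyc i j l + cyc i k l + cyc j k l"
    (is "_ = ?C")
proof -
  have c: "(transpose i j \<circ> transpose i k) \<circ> (transpose i j \<circ> transpose k l) = transpose j l \<circ> transpose j k"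
    "(transpose i k \<circ> transpose i j) \<circ> (transpose i j \<circ> transpose k l) = transpose i l \<circ> transpose i k"
    "(transpose i j \<circ> transpose i k) \<circ> (transpose i k \<circ> transpose j l) = transpose i l \<circ> transpose i j"
    "(transpose i k \<circ> transpose i j) \<circ> (transpose i k \<circ> transpose j l) = transpose j k \<circ> transpose j l"
    "(transpose i j \<circ> transpose i k) \<circ> (transpose i l \<circ> transpose j k) = transpose i k \<circ> transpose i l"
    "(transpose i k \<circ> transpose i j) \<circ> (transpose i l \<circ> transpose j k) = transpose i j \<circ> transpose i l"
    using assms
    by (intro ext; case_tac "x \<in> {i, j, k, l}"; auto)+
  have "(tau i j * tau i k) * (tau i j * tau k l) = tau j l * tau j k"
    "(tau i k * tau i j) * (tau i j * tau k l) = tau i l * tau i k"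
    "(tau i j * tau i k) * (tau i k * tau j l) = tau i l * tau i j"
    "(tau i k * tau i j) * (tau i k * tau j l) = tau j k * tau j l"
    "(tau i j * tau i k) * (tau i l * tau j k) = tau i k * tau i l"
    "(tau i k * tau i j) * (tau i l * tau j k) = tau i j * tau i l"
    by (rule c[THEN tau_word_eqI])+
  then show ?thesis
    by (simp add: cyc_def klein_def distrib_left distrib_right add_ac)
qed

lemma klein_absorb:
  assumes "distinct [i, j, k, l]"
  shows "tau i j * (tau k l * klein i j k l) = klein i j k l"
proof -
  have c: "(transpose i j \<circ> transpose k l) \<circ> (transpose i k \<circ> transpose j l) = transpose i l \<circ> transpose j k"
    "(transpose i j \<circ> transpose k l) \<circ> (transpose i l \<circ> transpose j k) = transpose i k \<circ> transpose j l"
    using assms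
    by (intro ext; case_tac "x \<in> {i, j, k, l}"; auto)+
  have "(tau i j * tau k l) * (tau i k * tau j l) = tau i l * tau j k"
    "(tau i j * tau k l) * (tau i l * tau j k) = tau i k * tau j l"
    by (rule c[THEN tau_word_eqI])+
  moreover have "(tau i j * tau k l) * (tau i j * tau k l) = 1"
    using assms by (subst (2) tau_disjoint) (auto simp: mult.assoc)
  ultimately have "(tau i j * tau k l) * klein i j k l = klein i j k l"
    by (simp add: klein_def distrib_left distrib_right add_ac)
  then show ?thesis by (simp add: mult.assoc)
qed

lemma klein_square:
  assumes "distinct [i, j, k, l]"
  shows "klein i j k l * klein i j k l = 4 *\<^sub>R klein i j k l"
proof -
  let ?V = "klein i j k l"
  have 4: "4 *\<^sub>R x = x + x + x + x" for x :: "'a group_algebra"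
    using scaleR_add_left[of 2 2 x] by (simp add: scaleR_2 add_ac)
  have "klein i l j k = klein i j l k"
    using assms by (intro klein_swap) auto
  then have "klein i k j l = ?V" "klein i l j k = ?V"
    using klein_swap[OF assms] by simp_all
  then have "tau i k * (tau j l * ?V) = ?V" "tau i l * (tau j k * ?V) = ?V"
    using klein_absorb[of i k j l] klein_absorb[of i l j k] assms by auto
  then show ?thesis
    using klein_absorb[OF assms] unfolding klein_def[of i j k l, THEN arg_cong[of _ _ "\<lambda>x. x * ?V"]]
    by (simp add: distrib_right mult.assoc 4)
qed

lemma star_klein:
  assumes "distinct [i, j, k, l]"
  shows "star (klein i j k l) = klein i j k l"
proof -
  have "tau k l * tau i j = tau i j * tau k l" "tau j k * tau i l = tau i l * tau j k"
    "tau j l * tau i k = tau i k * tau j l"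
    using assms by (auto intro: tau_disjoint)
  then show ?thesis by (simp add: klein_def star_simps star_tau)
qed

lemma star_cyc: "star (cyc i j k) = cyc i j k"
  by (simp add: cyc_def star_simps star_tau add.commute)

lemma star_four_point: "distinct [i, j, k, l] \<Longrightarrow> star (four_point i j k l) = four_point i j k l"
  by (simp add: four_point_def star_simps star_klein star_cyc del: distinct.simps)

text \<open>
  For a 3-cycle \<open>c\<close>, the first factor \<open>2 - c - c\<^sup>-\<^sup>1\<close> is three times a projection and the second four times a
  projection, and they commute; hence the factor 12 in the square.
\<close>

lemma four_point_factor:
  assumes "distinct [i, j, k, l]"
  shows "four_point i j k l = (2 *\<^sub>R 1 - cyc i j k) * klein i j k l"
    and "four_point i j k l = klein i j k l * (2 *\<^sub>R 1 - cyc i j k)"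
proof -
  show *: "four_point i j k l = (2 *\<^sub>R 1 - cyc i j k) * klein i j k l"
    unfolding left_diff_distrib cyc_klein[OF assms] by (simp add: four_point_def scaleR_2 mult_2)
  show "four_point i j k l = klein i j k l * (2 *\<^sub>R 1 - cyc i j k)"
    using arg_cong[OF *, of star] by (simp only: star_four_point[OF assms] star_simps star_klein[OF assms] star_cyc)
qed

lemma cyc_square:
  assumes "distinct [i, j, k]"
  shows "cyc i j k * cyc i j k = 2 *\<^sub>R 1 + cyc i j k"
proof -
  have c: "(transpose i j \<circ> transpose i k) \<circ> (transpose i j \<circ> transpose i k) = transpose i k \<circ> transpose i j"
    "(transpose i k \<circ> transpose i j) \<circ> (transpose i k \<circ> transpose i j) = transpose i j \<circ> transpose i k"
    using assms
    by (intro ext; case_tac "x \<in> {i, j, k}"; auto)+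
  have "(tau i j * tau i k) * (tau i j * tau i k) = tau i k * tau i j"
    "(tau i k * tau i j) * (tau i k * tau i j) = tau i j * tau i k"
    by (rule c[THEN tau_word_eqI])+
  moreover have "(tau i j * tau i k) * (tau i k * tau i j) = 1"
    "(tau i k * tau i j) * (tau i j * tau i k) = 1"
    by (simp_all add: mult.assoc)
  ultimately show ?thesis by (simp add: cyc_def distrib_left distrib_right scaleR_2 add_ac)
qed

lemma four_point_square:
  assumes "distinct [i, j, k, l]"
  shows "four_point i j k l * four_point i j k l = 12 *\<^sub>R four_point i j k l"
proof -
  let ?Z = "2 *\<^sub>R 1 - cyc i j k" and ?V = "klein i j k l"
  have "?Z * ?Z = 3 *\<^sub>R ?Z"
    using cyc_square[of i j k] assms distrib_right[of 2 1 "cyc i j k"]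
    by (simp add: scaleR_conv_of_real left_diff_distrib right_diff_distrib mult_2 mult_2_right)
  then have "(?V * ?Z) * (?Z * ?V) = 3 *\<^sub>R ((?V * ?Z) * ?V)"
    by (simp add: mult.assoc flip: mult.assoc[of ?Z ?Z])
  also have "(?V * ?Z) * ?V = ?Z * (?V * ?V)"
    using four_point_factor[OF assms] by (simp add: mult.assoc)
  also have "\<dots> = 4 *\<^sub>R (?Z * ?V)"
    by (simp add: klein_square[OF assms])
  finally show ?thesis
    using four_point_factor[OF assms] by simp
qed

lemma four_point_absorb:
  assumes "distinct [i, j, k, l]"
  shows "tau i j * (tau k l * four_point i j k l) = four_point i j k l"
proof -
  have "tau i j * (tau k l * four_point i j k l) = (tau i j * (tau k l * klein i j k l)) * (2 *\<^sub>R 1 - cyc i j k)"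
    unfolding four_point_factor(2)[OF assms] by (simp only: mult.assoc)
  then show ?thesis
    by (simp only: klein_absorb[OF assms] four_point_factor(2)[OF assms])
qed

lemma three_cycle_sum_four_point:
  assumes "distinct [i, j, k, l]"
  shows "(cyc i j k + cyc i j l + cyc i k l + cyc j k l) * four_point i j k l = (- 4) *\<^sub>R four_point i j k l"
proof -
  have "klein i j k l * four_point i j k l = 4 *\<^sub>R four_point i j k l"
    unfolding four_point_factor(2)[OF assms]
    by (simp only: mult.assoc[symmetric] klein_square[OF assms] mult_scaleR_left)
  moreover have "cyc i j k + cyc i j l + cyc i k l + cyc j k l = klein i j k l + klein i j k l - four_point i j k l"
    by (simp add: four_point_def)
  ultimately have "(cyc i j k + cyc i j l + cyc i k l + cyc j k l) * four_point i j k l =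
      4 *\<^sub>R four_point i j k l + 4 *\<^sub>R four_point i j k l - 12 *\<^sub>R four_point i j k l"
    by (simp only: left_diff_distrib distrib_right four_point_square[OF assms])
  then show ?thesis by (simp flip: scaleR_add_left scaleR_diff_left)
qed

section \<open>Five points\<close>

text \<open>
  On an element \<open>W\<close> fixed by the double transposition \<open>(x w)(y u)\<close>, the transposition \<open>(y u)\<close> may be traded for
  \<open>(x w)\<close>. So a double transposition that moves the fifth point \<open>z\<close> acts on \<open>W\<close> like a 3-cycle that moves \<open>z\<close>.
\<close>

lemma double_transposition_as_three_cycle:
  assumes "distinct [z, x, y, u, w]" "tau x w * (tau y u * W) = W"
  shows "tau z x * (tau y u * W) = tau z w * (tau z x * W)"
proof -
  have "tau y u * W = (tau y u * tau x w) * (tau y u * W)"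
    by (simp add: mult.assoc assms(2))
  also have "tau y u * tau x w = tau x w * tau y u"
    using assms(1) by (intro tau_disjoint) auto
  also have "\<dots> * (tau y u * W) = tau x w * W"
    by (simp add: mult.assoc)
  finally have "tau z x * (tau y u * W) = (tau x z * tau x w) * W"
    by (simp add: mult.assoc tau_sym[of z x])
  also have "\<dots> = tau z w * (tau z x * W)"
    using tau_conj3[of x w z] assms by (simp add: mult.assoc tau_sym[of z x])
  finally show ?thesis .
qed

text \<open>
  In the sum on the left, the twelve double transpositions that move \<open>z\<close> occur with coefficient \<open>2\<close>, and the
  twelve 3-cycles that move \<open>z\<close> with coefficient \<open>-2\<close>. On the Klein-invariant element on the right they
  cancel in pairs. What remains acts by a scalar.
\<close>

lemma four_point_sum_absorb:
  assumes "distinct [z, a, b, c, d]"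
  shows "(four_point z b c d + four_point z a c d + four_point z a b d + four_point z a b c) * four_point a b c d
     = 12 *\<^sub>R four_point a b c d"
proof -
  have ne: "z \<noteq> a" "z \<noteq> b" "z \<noteq> c" "z \<noteq> d" "a \<noteq> b" "a \<noteq> c" "a \<noteq> d" "b \<noteq> c" "b \<noteq> d" "c \<noteq> d"
    using assms by auto
  note ne = ne ne[symmetric]
  define W where "W = four_point a b c d"
  have "four_point a d b c = four_point a b d c" "four_point a b d c = W" "four_point a c b d = W"
    using assms by (auto simp: W_def intro: four_point_swap)
  then have "four_point a c b d = W" "four_point a d b c = W"
    by simp_all
  then have W: "tau a b * (tau c d * W) = W" "tau a c * (tau b d * W) = W" "tau a d * (tau b c * W) = W"
    using assms four_point_absorb[of a b c d] four_point_absorb[of a c b d] four_point_absorb[of a d b c]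
    by (auto simp: W_def)
  have "tau c d * tau a b = tau a b * tau c d" "tau b d * tau a c = tau a c * tau b d"
    "tau b c * tau a d = tau a d * tau b c"
    using assms by (auto intro: tau_disjoint)
  then have W': "tau c d * (tau a b * W) = W" "tau b d * (tau a c * W) = W" "tau b c * (tau a d * W) = W"
    using W by (simp_all flip: mult.assoc)
  have h: "tau z a * (tau c d * W) = tau z b * (tau z a * W)"
    "tau z a * (tau b d * W) = tau z c * (tau z a * W)"
    "tau z a * (tau b c * W) = tau z d * (tau z a * W)"
    "tau z b * (tau c d * W) = tau z a * (tau z b * W)"
    "tau z b * (tau a d * W) = tau z c * (tau z b * W)"
    "tau z b * (tau a c * W) = tau z d * (tau z b * W)"
    "tau z c * (tau b d * W) = tau z a * (tau z c * W)"
    "tau z c * (tau a d * W) = tau z b * (tau z c * W)"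
    "tau z c * (tau a b * W) = tau z d * (tau z c * W)"
    "tau z d * (tau b c * W) = tau z a * (tau z d * W)"
    "tau z d * (tau a c * W) = tau z b * (tau z d * W)"
    "tau z d * (tau a b * W) = tau z c * (tau z d * W)"
    by (intro double_transposition_as_three_cycle; simp add: ne W W' tau_sym[of b a] tau_sym[of c a] tau_sym[of d a] tau_sym[of c b]
        tau_sym[of d b] tau_sym[of d c])+
  have "(four_point z b c d + four_point z a c d + four_point z a b d + four_point z a b c) * W
    = W + W + W + W + W + W + W + W - (cyc a b c + cyc a b d + cyc a c d + cyc b c d) * W"
    by (simp add: four_point_def klein_def cyc_def[of z] distrib_right left_diff_distrib mult.assoc h
        algebra_simps)
  also have "\<dots> = 12 *\<^sub>R W"
  proof -
    have "12 *\<^sub>R W = (1+1+1+1+1+1+1+1+4) *\<^sub>R W" by simp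
    also have "\<dots> = W + W + W + W + W + W + W + W + 4 *\<^sub>R W"
      unfolding scaleR_add_left scaleR_one ..
    finally show ?thesis using three_cycle_sum_four_point[of a b c d] assms by (simp add: W_def)
  qed
  finally show ?thesis by (simp add: W_def)
qed

lemma sym_alg_four_point:
  assumes "{i, j, k, l} \<subseteq> N"
  shows "four_point i j k l \<in> sym_alg N"
  using assms unfolding four_point_def klein_def cyc_def
  by (intro sym_alg_intros sym_alg_tau) auto

lemma sos_four_point:
  assumes "distinct [i, j, k, l]" "{i, j, k, l} \<subseteq> N"
  shows "sos N (four_point i j k l)"
  by (rule sos_scaled_projection[OF sym_alg_four_point[OF assms(2)] star_four_point[OF assms(1)]
        four_point_square[OF assms(1)]]) simp

text \<open>
  Write \<open>F\<close> for the sum of all five terms and \<open>P\<close> for the subtracted one. Each of the five can play the role of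
  \<open>P\<close> in the previous lemma, so \<open>F\<^sup>2 = 24 F\<close> and \<open>F P = P F = 24 P\<close>, which makes \<open>F - 2 P\<close> a multiple of a
  projection.
\<close>

lemma sos_five_points:
  assumes "distinct [z, a, b, c, d]" "{z, a, b, c, d} \<subseteq> N"
  shows "sos N (four_point z b c d + four_point z a c d + four_point z a b d + four_point z a b c - four_point a b c d)"
proof -
  have ne: "z \<noteq> a" "z \<noteq> b" "z \<noteq> c" "z \<noteq> d" "a \<noteq> b" "a \<noteq> c" "a \<noteq> d" "b \<noteq> c" "b \<noteq> d" "c \<noteq> d"
    using assms by auto
  note ne = ne ne[symmetric]
  define P Ka Kb Kc Kd where defs: "P = four_point a b c d" "Ka = four_point z b c d" "Kb = four_point z a c d"
    "Kc = four_point z a b d" "Kd = four_point z a b c"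
  define F where "F = Ka + Kb + Kc + Kd + P"
  have eqs: "four_point a z c d = Kb" "four_point a z b d = Kc" "four_point a z b c = Kd"
    "four_point b a c d = P" "four_point b z c d = Ka" "four_point b z a d = Kc" "four_point b z a c = Kd"
    "four_point c a b d = P" "four_point c z b d = Ka" "four_point c z a d = Kb" "four_point c z a b = Kd"
    "four_point d a b c = P" "four_point d z b c = Ka" "four_point d z a c = Kb" "four_point d z a b = Kc"
    by (simp_all add: defs four_point_swap ne)
  have sq: "P * P = 12 *\<^sub>R P" "Ka * Ka = 12 *\<^sub>R Ka" "Kb * Kb = 12 *\<^sub>R Kb" "Kc * Kc = 12 *\<^sub>R Kc"
    "Kd * Kd = 12 *\<^sub>R Kd"
    unfolding defs using assms(1) by (auto intro: four_point_square)
  have "(Ka + Kb + Kc + Kd) * P = 12 *\<^sub>R P"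
    "(P + Kb + Kc + Kd) * Ka = 12 *\<^sub>R Ka"
    "(P + Ka + Kc + Kd) * Kb = 12 *\<^sub>R Kb"
    "(P + Ka + Kb + Kd) * Kc = 12 *\<^sub>R Kc"
    "(P + Ka + Kb + Kc) * Kd = 12 *\<^sub>R Kd"
    using four_point_sum_absorb[of z a b c d] four_point_sum_absorb[of a z b c d] four_point_sum_absorb[of b z a c d]
      four_point_sum_absorb[of c z a b d] four_point_sum_absorb[of d z a b c]
    by (simp_all add: ne eqs flip: defs)
  then have "(Ka + Kb + Kc + Kd) * P + P * P = 24 *\<^sub>R P"
    "(P + Kb + Kc + Kd) * Ka + Ka * Ka = 24 *\<^sub>R Ka"
    "(P + Ka + Kc + Kd) * Kb + Kb * Kb = 24 *\<^sub>R Kb"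
    "(P + Ka + Kb + Kd) * Kc + Kc * Kc = 24 *\<^sub>R Kc"
    "(P + Ka + Kb + Kc) * Kd + Kd * Kd = 24 *\<^sub>R Kd"
    by (simp_all only: sq flip: scaleR_add_left) simp_all
  then have FK: "F * P = 24 *\<^sub>R P" "F * Ka = 24 *\<^sub>R Ka" "F * Kb = 24 *\<^sub>R Kb" "F * Kc = 24 *\<^sub>R Kc"
    "F * Kd = 24 *\<^sub>R Kd"
    by (simp_all add: F_def distrib_right add_ac)
  have FF: "F * F = 24 *\<^sub>R F"
    using FK unfolding F_def[THEN arg_cong[of _ _ "\<lambda>x. F * x"]]
    by (simp add: distrib_left F_def scaleR_add_right)
  have st: "star P = P" "star F = F"
    using assms(1) by (simp_all add: F_def defs star_simps star_four_point)
  have PF: "P * F = 24 *\<^sub>R P"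
    using arg_cong[OF FK(1), of star] by (simp add: star_simps st)
  have "(F - 2 *\<^sub>R P) * (F - 2 *\<^sub>R P) = 24 *\<^sub>R (F - 2 *\<^sub>R P)"
    by (simp add: left_diff_distrib right_diff_distrib FF FK PF sq scaleR_right_diff_distrib)
  moreover have "F - 2 *\<^sub>R P \<in> sym_alg N"
    unfolding F_def defs using assms(2) by (intro sym_alg_intros sym_alg_four_point) auto
  ultimately have "sos N (F - 2 *\<^sub>R P)"
    by (intro sos_scaled_projection[where r = 24]) (simp_all add: star_simps st)
  then show ?thesis
    by (simp add: F_def defs scaleR_2)
qed

section \<open>The octopus inequality\<close>

text \<open>
  For weights with \<open>x\<^sub>z = - \<Sum>\<^sub>a x\<^sub>a\<close>, the form \<open>\<Sum>\<^sub>i\<^sub>j x\<^sub>i x\<^sub>j (i j)\<close> over leaves and root equals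
  \<open>\<Sum>\<^sub>a\<^sub>b x\<^sub>a x\<^sub>b \<mu>\<^sub>a\<^sub>b\<close> over the leaves alone.
\<close>

definition mu :: "'a \<Rightarrow> 'a \<Rightarrow> 'a \<Rightarrow> 'a group_algebra" where
  "mu z a b = tau a b - tau z a - tau z b + 1"

text \<open>
  With \<open>M = \<Sum>\<^sub>a\<^sub>b x\<^sub>a x\<^sub>b \<mu>\<^sub>a\<^sub>b\<close> and \<open>q = (\<Sum>\<^sub>a x\<^sub>a)\<^sup>2 + \<Sum>\<^sub>a x\<^sub>a\<^sup>2\<close>, these are the coefficients of \<open>x\<^sub>a x\<^sub>b x\<^sub>c x\<^sub>d\<close> in
  \<open>2 q M - M\<^sup>2\<close>. The conditional accounts for the diagonal part \<open>\<Sum>\<^sub>a x\<^sub>a\<^sup>2\<close> of \<open>q\<close>.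
\<close>

definition defect :: "'a \<Rightarrow> 'a \<Rightarrow> 'a \<Rightarrow> 'a \<Rightarrow> 'a \<Rightarrow> 'a group_algebra" where
  "defect z a b c d = mu z c d + mu z c d + (if a = b then mu z c d + mu z c d else 0)
     - mu z a b * mu z c d"

text \<open>
  As \<open>\<mu>\<close> is symmetric, summing over the three pairings of the four indices and over the order of the two
  pairs already symmetrises completely.
\<close>

definition defect_sym :: "'a \<Rightarrow> 'a \<Rightarrow> 'a \<Rightarrow> 'a \<Rightarrow> 'a \<Rightarrow> 'a group_algebra" where
  "defect_sym z a b c d = defect z a b c d + defect z c d a b + defect z a c b d + defect z b d a c
     + defect z a d b c + defect z b c a d"

lemma mu_sym: "mu z a b = mu z b a"
  by (simp add: mu_def tau_sym[of a b] algebra_simps)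

lemma defect_sym_swap:
  "defect_sym z b a c d = defect_sym z a b c d"
  "defect_sym z a c b d = defect_sym z a b c d"
  "defect_sym z a b d c = defect_sym z a b c d"
  unfolding defect_sym_def defect_def
  by (simp_all add: mu_sym[of z b a] mu_sym[of z c a] mu_sym[of z c b] mu_sym[of z d c]
      mu_sym[of z d b] eq_commute[of b a] eq_commute[of c b] eq_commute[of d c] algebra_simps)

lemma defect_sym_distinct:
  assumes "distinct [z, a, b, c, d]"
  shows "defect_sym z a b c d =
    four_point z b c d + four_point z a c d + four_point z a b d + four_point z a b c - four_point a b c d"
proof -
  have "tau c d * tau a b = tau a b * tau c d" "tau b d * tau a c = tau a c * tau b d"
    "tau b c * tau a d = tau a d * tau b c"
    "tau a b * tau z c = tau z c * tau a b" "tau a b * tau z d = tau z d * tau a b"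
    "tau a c * tau z b = tau z b * tau a c" "tau a c * tau z d = tau z d * tau a c"
    "tau a d * tau z b = tau z b * tau a d" "tau a d * tau z c = tau z c * tau a d"
    "tau b c * tau z a = tau z a * tau b c" "tau b c * tau z d = tau z d * tau b c"
    "tau b d * tau z a = tau z a * tau b d" "tau b d * tau z c = tau z c * tau b d"
    "tau c d * tau z a = tau z a * tau c d" "tau c d * tau z b = tau z b * tau c d"
    using assms by (auto intro: tau_disjoint)
  then show ?thesis
    using assms by (simp add: defect_sym_def defect_def mu_def four_point_def klein_def cyc_def algebra_simps)
qed

lemma tau_triangle:
  assumes "z \<noteq> a" "z \<noteq> c" "a \<noteq> c"
  shows "tau a c * tau z a = tau z a * tau z c" "tau z a * tau a c = tau z c * tau z a"
    "tau a c * tau z c = tau z c * tau z a" "tau z c * tau a c = tau z a * tau z c"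
  using tau_conj3[of z c a] tau_conj3[of a c z] tau_conj3[of z a c] tau_conj3[of c a z] assms
  by (simp_all add: tau_sym[of a z] tau_sym[of c z] tau_sym[of c a])

text \<open>
  When exactly two of the four leaves coincide, only the four-element set formed by the root and the three
  distinct leaves contributes.
\<close>

lemma defect_sym_one_pair:
  assumes "distinct [z, a, c, d]"
  shows "defect_sym z a a c d = four_point z a c d + four_point z a c d"
proof -
  have "tau c d * tau z a = tau z a * tau c d" "tau a c * tau z d = tau z d * tau a c"
    "tau a d * tau z c = tau z c * tau a d"
    using assms by (auto intro: tau_disjoint)
  then show ?thesis
    using assms tau_triangle[of z a c] tau_triangle[of z a d]
    by (simp add: defect_sym_def defect_def mu_def four_point_def klein_def cyc_def algebra_simps
        mult_2 mult_2_right)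
qed

lemma defect_sym_degenerate:
  assumes "z \<noteq> a" "z \<noteq> c"
  shows "defect_sym z a a c c = 0" "defect_sym z a a a c = 0"
  using assms tau_triangle[of z a c]
  by (cases "a = c"; simp add: defect_sym_def defect_def mu_def algebra_simps mult_2 mult_2_right)+

lemma sos_defect_sym:
  assumes "{z, a, b, c, d} \<subseteq> N" "z \<notin> {a, b, c, d}"
  shows "sos N (defect_sym z a b c d)"
proof -
  have pair: "sos N (defect_sym z x x u v)" if N: "{z, x, u, v} \<subseteq> N" "z \<notin> {x, u, v}" for x u v
  proof (cases "distinct [z, x, u, v]")
    case True
    then show ?thesis
      using N by (simp add: defect_sym_one_pair) (intro sos_add sos_four_point; simp)
  next
    case False
    then consider "u = v" | "u = x" | "v = x" using N by auto
    then have "defect_sym z x x u v = 0"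
      using N defect_sym_swap(3)[of z x x u v] by cases (auto simp: defect_sym_degenerate)
    then show ?thesis by (simp add: sos_zero)
  qed
  show ?thesis
  proof (cases "distinct [z, a, b, c, d]")
    case True
    then show ?thesis using assms(1) by (simp only: defect_sym_distinct sos_five_points)
  next
    case False
    then consider "a = b" | "a = c" | "a = d" | "b = c" | "b = d" | "c = d" using assms by auto
    then show ?thesis
    proof cases
      case 1 then show ?thesis using pair assms by auto
    next
      case 2 then show ?thesis using pair[of a b d] assms defect_sym_swap(2)[of z a a b d] by auto
    next
      case 3 then show ?thesis using pair[of a b c] assms
          defect_sym_swap(3)[of z a b a c] defect_sym_swap(2)[of z a a b c] by auto
    next
      case 4 then show ?thesis using pair[of b a d] assms
          defect_sym_swap(1)[of z b a b d] defect_sym_swap(2)[of z b b a d] by auto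
    next
      case 5 then show ?thesis using pair[of b a c] assms defect_sym_swap(3)[of z a b b c]
          defect_sym_swap(1)[of z b a b c] defect_sym_swap(2)[of z b b a c] by auto
    next
      case 6 then show ?thesis using pair[of c a b] assms defect_sym_swap(2)[of z a c b c]
          defect_sym_swap(3)[of z a c c b] defect_sym_swap(1)[of z c a c b] defect_sym_swap(2)[of z c c a b]
        by auto
    qed
  qed
qed

text \<open>
  These adjacent transpositions generate all permutations of the four summation indices.
\<close>

lemma sum4_swap:
  fixes f :: "'a \<Rightarrow> 'a \<Rightarrow> 'a \<Rightarrow> 'a \<Rightarrow> 'b::real_vector" and x :: "'a \<Rightarrow> real"
    and B :: "'a set"
  defines "T \<equiv> (\<lambda>f. \<Sum>a\<in>B. \<Sum>b\<in>B. \<Sum>c\<in>B. \<Sum>d\<in>B. (x a * x b * x c * x d) *\<^sub>R f a b c d)"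
  shows "T (\<lambda>a b c d. f b a c d) = T f"
    and "T (\<lambda>a b c d. f a c b d) = T f"
    and "T (\<lambda>a b c d. f a b d c) = T f"
proof -
  show "T (\<lambda>a b c d. f b a c d) = T f"
    unfolding T_def by (subst sum.swap) (simp add: mult_ac)
  show "T (\<lambda>a b c d. f a c b d) = T f"
    unfolding T_def by (rule sum.cong[OF refl], subst sum.swap) (simp add: mult_ac)
  show "T (\<lambda>a b c d. f a b d c) = T f"
    unfolding T_def by (rule sum.cong[OF refl], rule sum.cong[OF refl], subst sum.swap) (simp add: mult_ac)
qed

definition link :: "'a \<Rightarrow> 'a \<Rightarrow> 'a group_algebra" where
  "link i j = 1 - tau i j"

lemma link_same [simp]: "link i i = 0"
  by (simp add: link_def)

lemma link_sym: "link i j = link j i"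
  by (simp add: link_def tau_sym)

lemma sym_alg_link: "i \<in> N \<Longrightarrow> j \<in> N \<Longrightarrow> link i j \<in> sym_alg N"
  unfolding link_def by (intro sym_alg_intros sym_alg_tau)

lemma sos_link:
  assumes "i \<in> N" "j \<in> N"
  shows "sos N (link i j)"
proof (rule sos_scaled_projection[OF sym_alg_link[OF assms]])
  show "link i j * link i j = 2 *\<^sub>R link i j"
    by (simp add: link_def algebra_simps scaleR_2)
qed (simp_all add: link_def star_simps star_tau)

text \<open>
  Put \<open>M\<close> for the element in question. The sum of the symmetrised coefficients gives \<open>12 q M = 6 M\<^sup>2 + \<dots>\<close> with
  sums of squares on the right. One can divide by \<open>q\<close>, because \<open>q = 0\<close> forces all weights to vanish.
\<close>

theorem octopus:
  fixes x :: "'a \<Rightarrow> real"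
  assumes "finite B" "B \<subseteq> N" "z \<in> N" "z \<notin> B" and x: "\<And>a. a \<in> B \<Longrightarrow> 0 \<le> x a"
  shows "sos N ((2 * (\<Sum>a\<in>B. x a)) *\<^sub>R (\<Sum>a\<in>B. x a *\<^sub>R link z a)
     - (\<Sum>a\<in>B. \<Sum>b\<in>B. (x a * x b) *\<^sub>R link a b))"
proof -
  define M where "M = (\<Sum>a\<in>B. \<Sum>b\<in>B. (x a * x b) *\<^sub>R mu z a b)"
  define X where "X = (\<Sum>a\<in>B. x a)"
  define q where "q = X * X + (\<Sum>a\<in>B. x a * x a)"
  define T :: "('a \<Rightarrow> 'a \<Rightarrow> 'a \<Rightarrow> 'a \<Rightarrow> 'a group_algebra) \<Rightarrow> 'a group_algebra"
    where "T = (\<lambda>f. \<Sum>a\<in>B. \<Sum>b\<in>B. \<Sum>c\<in>B. \<Sum>d\<in>B. (x a * x b * x c * x d) *\<^sub>R f a b c d)"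
  have T_add: "T (\<lambda>a b c d. f a b c d + g a b c d) = T f + T g" for f g
    by (simp add: T_def scaleR_add_right sum.distrib)
  have T_diff: "T (\<lambda>a b c d. f a b c d - g a b c d) = T f - T g" for f g
    by (simp add: T_def scaleR_diff_right sum_subtractf)
  have T_swap: "T (\<lambda>a b c d. f b a c d) = T f" "T (\<lambda>a b c d. f a c b d) = T f"
    "T (\<lambda>a b c d. f a b d c) = T f" for f
    unfolding T_def by (rule sum4_swap)+
  have pull: "(\<Sum>a\<in>B. \<Sum>b\<in>B. (x a * x b) *\<^sub>R f b) = X *\<^sub>R (\<Sum>b\<in>B. x b *\<^sub>R f b)"
    for f :: "'a \<Rightarrow> 'a group_algebra"
    by (subst sum.swap)
      (simp add: X_def scaleR_sum_right sum_distrib_right flip: scaleR_sum_left)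
  have inner: "(\<Sum>c\<in>B. \<Sum>d\<in>B. (x a * x b * x c * x d) *\<^sub>R mu z c d) = (x a * x b) *\<^sub>R M" for a b
    by (simp add: M_def scaleR_sum_right mult.assoc)
  have M_eq: "M = (2 * X) *\<^sub>R (\<Sum>a\<in>B. x a *\<^sub>R link z a) - (\<Sum>a\<in>B. \<Sum>b\<in>B. (x a * x b) *\<^sub>R link a b)"
  proof -
    have "mu z a b = link z a + link z b - link a b" for a b
      by (simp add: mu_def link_def)
    then have "M = (\<Sum>a\<in>B. \<Sum>b\<in>B. (x a * x b) *\<^sub>R link z a) + (\<Sum>a\<in>B. \<Sum>b\<in>B. (x a * x b) *\<^sub>R link z b)
        - (\<Sum>a\<in>B. \<Sum>b\<in>B. (x a * x b) *\<^sub>R link a b)"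
      by (simp add: M_def scaleR_add_right scaleR_diff_right sum.distrib sum_subtractf)
    moreover have "(\<Sum>a\<in>B. \<Sum>b\<in>B. (x a * x b) *\<^sub>R link z b) = X *\<^sub>R (\<Sum>a\<in>B. x a *\<^sub>R link z a)"
      by (rule pull)
    moreover have "(\<Sum>a\<in>B. \<Sum>b\<in>B. (x a * x b) *\<^sub>R link z a) = X *\<^sub>R (\<Sum>a\<in>B. x a *\<^sub>R link z a)"
      by (simp add: X_def scaleR_sum_right sum_distrib_left sum_distrib_right mult.commute flip: scaleR_sum_left)
    ultimately show ?thesis
      by (simp only: mult_2 scaleR_add_left)
  qed
  have T_MM: "T (\<lambda>a b c d. mu z a b * mu z c d) = M * M"
  proof -
    have "mu z a b * M = (\<Sum>c\<in>B. \<Sum>d\<in>B. (x c * x d) *\<^sub>R (mu z a b * mu z c d))" for a b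
      by (simp add: M_def sum_distrib_left)
    moreover have "M * M = (\<Sum>a\<in>B. \<Sum>b\<in>B. (x a * x b) *\<^sub>R (mu z a b * M))"
      by (subst (1) M_def) (simp add: sum_distrib_right)
    ultimately show ?thesis
      by (simp add: T_def scaleR_sum_right mult.assoc)
  qed
  have T_mu: "T (\<lambda>a b c d. mu z c d) = (X * X) *\<^sub>R M"
    by (simp add: T_def inner X_def sum_product flip: scaleR_sum_left)
  have T_diag: "T (\<lambda>a b c d. if a = b then mu z c d else 0) = (\<Sum>a\<in>B. x a * x a) *\<^sub>R M"
  proof -
    have "(\<Sum>c\<in>B. \<Sum>d\<in>B. (x a * x b * x c * x d) *\<^sub>R (if a = b then mu z c d else 0))
        = (if a = b then (x a * x a) *\<^sub>R M else 0)" for a b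
      using inner[of a b] by (cases "a = b") simp_all
    then show ?thesis
      using assms(1) by (simp add: T_def scaleR_sum_left)
  qed
  have T_defect: "T (defect z) = (2 * q) *\<^sub>R M - M * M"
  proof -
    have "T (defect z) = T (\<lambda>a b c d. ((mu z c d + mu z c d) + ((if a = b then mu z c d else 0)
        + (if a = b then mu z c d else 0))) - mu z a b * mu z c d)"
      by (rule arg_cong[of _ _ T]) (auto simp: defect_def fun_eq_iff)
    also have "\<dots> = (2 * q) *\<^sub>R M - M * M"
      unfolding T_add T_diff T_MM T_mu T_diag by (simp only: q_def mult_2 scaleR_add_left add_ac)
    finally show ?thesis .
  qed
  have T_sym: "T (defect_sym z) = 6 *\<^sub>R T (defect z)"
  proof -
    have 1: "T (\<lambda>a b c d. defect z a c b d) = T (defect z)"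
      by (rule T_swap(2)[of "defect z"])
    have 2: "T (\<lambda>a b c d. defect z a d b c) = T (defect z)"
      using T_swap(3)[of "\<lambda>a b c d. defect z a c b d"] 1 by simp
    have 3: "T (\<lambda>a b c d. defect z b d a c) = T (defect z)"
      using T_swap(1)[of "\<lambda>a b c d. defect z a d b c"] 2 by simp
    have 4: "T (\<lambda>a b c d. defect z c d a b) = T (defect z)"
      using T_swap(2)[of "\<lambda>a b c d. defect z b d a c"] 3 by simp
    have 5: "T (\<lambda>a b c d. defect z b c a d) = T (defect z)"
      using T_swap(1)[of "\<lambda>a b c d. defect z a c b d"] 1 by simp
    have "T (defect_sym z) = T (defect z) + T (defect z) + T (defect z) + T (defect z) + T (defect z) + T (defect z)"
      unfolding defect_sym_def T_add 1 2 3 4 5 ..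
    also have "\<dots> = (1 + 1 + 1 + 1 + 1 + 1) *\<^sub>R T (defect z)"
      unfolding scaleR_add_left scaleR_one ..
    finally show ?thesis by simp
  qed
  have alg: "M \<in> sym_alg N"
    unfolding M_def mu_def using assms(2,3) by (intro sym_alg_intros sym_alg_tau) auto
  have star: "star M = M"
    unfolding M_def mu_def by (simp add: star_simps star_tau)
  have "sos N (T (defect_sym z))"
    unfolding T_def using assms by (intro sos_sum sos_scaleR sos_defect_sym mult_nonneg_nonneg) auto
  then have "sos N (T (defect_sym z) + 6 *\<^sub>R (star M * M))"
    using alg by (intro sos_add sos_scaleR sos_square) simp_all
  also have "T (defect_sym z) + 6 *\<^sub>R (star M * M) = (12 * q) *\<^sub>R M"
    by (simp add: T_sym T_defect star scaleR_diff_right)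
  finally have main: "sos N ((12 * q) *\<^sub>R M)" .
  have "sos N M"
  proof (cases "q = 0")
    case True
    have "0 \<le> X * X" "0 \<le> (\<Sum>a\<in>B. x a * x a)" by (simp_all add: sum_nonneg)
    then have "(\<Sum>a\<in>B. x a * x a) = 0" using True unfolding q_def by linarith
    then have "x a = 0" if "a \<in> B" for a
      using assms(1) that by (simp add: sum_nonneg_eq_0_iff)
    then have "M = 0" by (simp add: M_def)
    then show ?thesis by (simp add: sos_zero)
  next
    case False
    moreover have "0 \<le> q" by (simp add: q_def sum_nonneg)
    ultimately show ?thesis using main by (simp add: sos_scaleR_iff)
  qed
  then show ?thesis by (simp add: M_eq X_def)
qed

section \<open>Averages over symmetric subgroups and the complete graph\<close>

definition avg :: "'a set \<Rightarrow> 'a group_algebra" where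
  "avg A = (1 / fact (card A)) *\<^sub>R (\<Sum>\<pi> | \<pi> permutes A. perm_elt \<pi>)"

lemma avg_empty [simp]: "avg {} = 1"
  by (simp add: avg_def)

lemma perm_elt_avg:
  assumes "\<pi> permutes A"
  shows "perm_elt \<pi> * avg A = avg A"
proof -
  have "perm_elt \<pi> * (\<Sum>\<sigma> | \<sigma> permutes A. perm_elt \<sigma>) = (\<Sum>\<sigma> | \<sigma> permutes A. perm_elt (\<pi> \<circ> \<sigma>))"
    using assms by (auto simp: sum_distrib_left perm_elt_mult permutes_bij intro!: sum.cong)
  also have "\<dots> = (\<Sum>\<sigma> | \<sigma> permutes A. perm_elt \<sigma>)"
    by (rule setum_permutations_compose_left[OF assms, symmetric])
  finally show ?thesis by (simp add: avg_def)
qed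

lemma star_avg: "star (avg A) = avg A"
proof -
  have "star (\<Sum>\<sigma> | \<sigma> permutes A. perm_elt \<sigma>) = (\<Sum>\<sigma> | \<sigma> permutes A. perm_elt (inv_into UNIV \<sigma>))"
    by (auto simp: star_sum star_perm_elt permutes_bij intro!: sum.cong)
  also have "\<dots> = (\<Sum>\<sigma> | \<sigma> permutes A. perm_elt \<sigma>)"
    by (rule sum_permutations_inverse[symmetric])
  finally show ?thesis by (simp add: avg_def star_scaleR)
qed

lemma avg_mult:
  assumes "finite A" "B \<subseteq> A"
  shows "avg B * avg A = avg A" "avg A * avg B = avg A"
proof -
  have "finite B" using assms by (rule finite_subset[rotated])
  have "(\<Sum>\<pi> | \<pi> permutes B. perm_elt \<pi>) * avg A = (\<Sum>\<pi> | \<pi> permutes B. avg A)"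
    unfolding sum_distrib_right
    using assms(2) by (intro sum.cong refl perm_elt_avg) (auto intro: permutes_subset)
  also have "\<dots> = real (fact (card B)) *\<^sub>R avg A"
    using card_permutations[OF refl \<open>finite B\<close>] by (simp add: scaleR_conv_of_real)
  finally show *: "avg B * avg A = avg A"
    by (simp add: avg_def[of B])
  show "avg A * avg B = avg A"
    using arg_cong[OF *, of star] by (simp add: star_simps star_avg)
qed

lemma sym_alg_avg: "A \<subseteq> N \<Longrightarrow> avg A \<in> sym_alg N"
  unfolding avg_def by (intro sym_alg_intros sym_alg_perm_elt) (auto intro: permutes_subset)

lemma avg_commute:
  assumes "\<And>\<pi>. \<pi> permutes A \<Longrightarrow> x * perm_elt \<pi> = perm_elt \<pi> * x"
  shows "x * avg A = avg A * x"
  using assms by (simp add: avg_def sum_distrib_left sum_distrib_right)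

lemma avg_commute_disjoint:
  assumes "A \<inter> B = {}"
  shows "avg A * avg B = avg B * avg A"
proof (rule avg_commute, rule avg_commute[symmetric])
  fix \<sigma> \<pi> assume p: "\<sigma> permutes B" "\<pi> permutes A"
  have "\<sigma> \<circ> \<pi> = \<pi> \<circ> \<sigma>"
  proof
    fix x
    show "(\<sigma> \<circ> \<pi>) x = (\<pi> \<circ> \<sigma>) x"
    proof (cases "x \<in> A")
      case True
      then have "\<pi> x \<in> A" using permutes_in_image[OF p(2)] by simp
      then have "\<pi> x \<notin> B" "x \<notin> B" using True assms by auto
      then show ?thesis using p by (simp add: permutes_not_in)
    next
      case False
      then have "\<sigma> x \<notin> A"
        using p(1) assms permutes_in_image[OF p(1)] permutes_not_in[OF p(1)]
        by (cases "x \<in> B") auto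
      then show ?thesis using False p(2) by (simp add: permutes_not_in)
    qed
  qed
  then show "perm_elt \<sigma> * perm_elt \<pi> = perm_elt \<pi> * perm_elt \<sigma>"
    using p by (simp add: perm_elt_mult permutes_bij)
qed

lemma avg_commute_nested:
  "finite A \<Longrightarrow> B \<subseteq> A \<Longrightarrow> avg A * avg B = avg B * avg A"
  by (simp add: avg_mult)

lemma tau_avg: "a \<in> A \<Longrightarrow> b \<in> A \<Longrightarrow> tau a b * avg A = avg A"
  by (simp add: tau_def perm_elt_avg permutes_swap_id)

lemma avg_tau: "a \<in> A \<Longrightarrow> b \<in> A \<Longrightarrow> avg A * tau a b = avg A"
  using arg_cong[OF tau_avg, of a A b star] by (simp add: star_simps star_avg star_tau)

text \<open>
  Conjugation by \<open>\<pi> \<in> Sym(A)\<close> permutes the transpositions \<open>(z a)\<close> with \<open>a \<in> A\<close>.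
\<close>

lemma avg_commute_spokes:
  assumes "z \<notin> A"
  shows "(\<Sum>a\<in>A. link z a) * avg A = avg A * (\<Sum>a\<in>A. link z a)"
proof (rule avg_commute)
  fix \<pi> assume p: "\<pi> permutes A"
  have "perm_elt \<pi> * (\<Sum>a\<in>A. link z a) = (\<Sum>a\<in>A. link z (\<pi> a)) * perm_elt \<pi>"
    using perm_elt_tau[of \<pi> z] permutes_bij[OF p] permutes_not_in[OF p assms]
    by (simp add: link_def sum_distrib_left sum_distrib_right left_diff_distrib right_diff_distrib)
  also have "(\<Sum>a\<in>A. link z (\<pi> a)) = (\<Sum>a\<in>A. link z a)"
    using sum.permute[OF p, of "link z"] by (simp add: o_def)
  finally show "(\<Sum>a\<in>A. link z a) * perm_elt \<pi> = perm_elt \<pi> * (\<Sum>a\<in>A. link z a)" ..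
qed

lemma avg_commute_link:
  assumes "i \<notin> A" "j \<notin> A"
  shows "link i j * avg A = avg A * link i j"
proof (rule avg_commute)
  fix \<pi> assume p: "\<pi> permutes A"
  then show "link i j * perm_elt \<pi> = perm_elt \<pi> * link i j"
    using perm_elt_tau[of \<pi> i j] permutes_bij[OF p] permutes_not_in[OF p] assms
    by (simp add: link_def left_diff_distrib right_diff_distrib)
qed

text \<open>
  The transpositions \<open>(z b)\<close> with \<open>b \<in> A\<close>, together with the identity, represent the cosets of \<open>Sym(A)\<close> in
  \<open>Sym(A \<union> {z})\<close>.
\<close>

lemma avg_insert:
  assumes "finite A" "z \<notin> A"
  shows "real (Suc (card A)) *\<^sub>R (1 - avg (insert z A))
    = real (Suc (card A)) *\<^sub>R (1 - avg A) + (\<Sum>a\<in>A. link z a) * avg A"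
proof -
  let ?S = "\<Sum>\<pi> | \<pi> permutes A. perm_elt \<pi>"
  have "(\<Sum>\<pi> | \<pi> permutes insert z A. perm_elt \<pi>) = (\<Sum>b\<in>insert z A. tau z b * ?S)"
    unfolding sum_over_permutations_insert[OF assms] sum_distrib_left tau_def
    by (auto simp: perm_elt_mult permutes_bij intro!: sum.cong)
  also have "\<dots> = ?S + (\<Sum>b\<in>A. tau z b) * ?S"
    using assms by (simp add: sum_distrib_right)
  finally have "real (Suc (card A)) *\<^sub>R avg (insert z A) = avg A + (\<Sum>b\<in>A. tau z b) * avg A"
    using assms by (simp add: avg_def field_simps scaleR_add_right del: of_nat_Suc)
  moreover have "(\<Sum>b\<in>A. tau z b) = real (card A) *\<^sub>R 1 - (\<Sum>a\<in>A. link z a)"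
    by (simp add: link_def sum_subtractf scaleR_conv_of_real)
  ultimately show ?thesis
    by (simp add: scaleR_diff_right left_diff_distrib scaleR_add_left)
qed

lemma one_minus_avg_idem: "finite A \<Longrightarrow> (1 - avg A) * (1 - avg A) = 1 - avg A"
  by (simp add: left_diff_distrib right_diff_distrib avg_mult)

text \<open>
  Induction on \<open>A\<close>. With \<open>e = e\<^sub>A\<close> and \<open>H = \<Sum>\<^sub>a (1 - (z a))\<close>, adding \<open>z\<close> to \<open>A\<close> increases the difference by
  \<open>2 (H - (1 - e)) (1 - e)\<close>. The octopus inequality with equal weights bounds \<open>2 |A| H\<close> below by the sum over
  \<open>A\<close>, and the induction hypothesis bounds that sum below by \<open>2 |A| (1 - e)\<close>; so \<open>H \<ge> 1 - e\<close>.
  Both sums run over ordered pairs, which explains the factor \<open>2\<close>.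
\<close>

theorem complete_graph_gap:
  assumes "finite A" "A \<subseteq> N"
  shows "sos N ((\<Sum>a\<in>A. \<Sum>b\<in>A. link a b) - (2 * real (card A)) *\<^sub>R (1 - avg A))"
  using assms
proof (induction A rule: finite_induct)
  case empty
  then show ?case by (simp add: sos_zero)
next
  case (insert z A)
  define L H e m where "L = (\<Sum>a\<in>A. \<Sum>b\<in>A. link a b)" and "H = (\<Sum>a\<in>A. link z a)"
    and "e = avg A" and "m = real (card A)"
  have IH: "sos N (L - (2 * m) *\<^sub>R (1 - e))"
    using insert by (simp add: L_def e_def m_def)
  have ee: "e * e = e" using insert by (simp add: e_def avg_mult)
  have ee': "e * (e * x) = e * x" for x by (simp add: ee flip: mult.assoc)
  have se: "star e = e" by (simp add: e_def star_avg)
  have He: "H * e = e * H" unfolding H_def e_def by (rule avg_commute_spokes) fact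
  have alg: "1 - e \<in> sym_alg N" unfolding e_def using insert by (intro sym_alg_intros sym_alg_avg) auto
  have K: "sos N (H - (1 - e))"
  proof (cases "A = {}")
    case True
    then show ?thesis by (simp add: H_def e_def sos_zero)
  next
    case False
    then have "0 < 2 * m" using insert by (simp add: m_def card_gt_0_iff)
    have "sos N ((2 * m) *\<^sub>R H - L)"
      using octopus[of A N z "\<lambda>_. 1"] insert by (simp add: H_def L_def m_def)
    moreover have "(2 * m) *\<^sub>R H - L + (L - (2 * m) *\<^sub>R (1 - e)) = (2 * m) *\<^sub>R (H - (1 - e))"
      by (simp add: scaleR_diff_right)
    ultimately have "sos N ((2 * m) *\<^sub>R (H - (1 - e)))"
      using sos_add[OF _ IH, of "(2 * m) *\<^sub>R H - L"] by (simp only:)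
    then show ?thesis using \<open>0 < 2 * m\<close> by (simp only: sos_scaleR_iff)
  qed
  have "(1 - e) * (H - (1 - e)) * star (1 - e) = (H - (1 - e)) * (1 - e)"
    using se by (simp add: star_simps algebra_simps ee ee' He)
  with sos_conj[OF K alg] have K': "sos N ((H - (1 - e)) * (1 - e))" by simp
  have "(\<Sum>a\<in>insert z A. \<Sum>b\<in>insert z A. link a b) = L + 2 *\<^sub>R H"
    using insert by (simp add: L_def H_def sum.distrib link_sym[of _ z] scaleR_2)
  moreover have "(2 * real (card (insert z A))) *\<^sub>R (1 - avg (insert z A))
     = 2 *\<^sub>R ((m + 1) *\<^sub>R (1 - e) + H * e)"
  proof -
    have "(2 * real (card (insert z A))) *\<^sub>R (1 - avg (insert z A))
        = 2 *\<^sub>R (real (Suc (card A)) *\<^sub>R (1 - avg (insert z A)))"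
      using insert by simp
    also have "\<dots> = 2 *\<^sub>R ((m + 1) *\<^sub>R (1 - e) + H * e)"
      unfolding avg_insert[OF insert(1,2)] by (simp add: H_def e_def m_def add.commute)
    finally show ?thesis .
  qed
  moreover have "L + 2 *\<^sub>R H - 2 *\<^sub>R ((m + 1) *\<^sub>R (1 - e) + H * e)
    = (L - (2 * m) *\<^sub>R (1 - e)) + 2 *\<^sub>R ((H - (1 - e)) * (1 - e))"
    using ee by (simp add: algebra_simps)
  ultimately show ?case
    using sos_add[OF IH sos_scaleR[OF K', of 2]] by (simp only: zero_le_numeral)
qed

section \<open>Disjoint blocks of leaves\<close>

lemma commute_mult:
  fixes p :: "'a::semigroup_mult"
  assumes "p * a = a * p" "p * b = b * p"
  shows "p * (a * b) = (a * b) * p"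
proof -
  have "p * (a * b) = a * (p * b)" using assms(1) by (simp flip: mult.assoc)
  then show ?thesis using assms(2) by (simp add: mult.assoc)
qed

lemma projection_absorb:
  fixes e :: "'a::semigroup_mult"
  assumes "e * e = e" "e * x = x * e"
  shows "e * x * e = e * x"
proof -
  have "e * x * e = e * (e * x)" by (simp only: assms(2)[symmetric] mult.assoc[of e x e])
  also have "\<dots> = e * x" by (simp only: mult.assoc[symmetric] assms(1))
  finally show ?thesis .
qed

text \<open>
  Joint spectral decomposition without eigenspaces: to show \<open>y \<ge> 0\<close> for an element that commutes with commuting
  projections \<open>p\<^sub>i\<close>, it suffices to look at the part where some \<open>p\<^sub>i\<close> vanishes and at the part where all
  \<open>p\<^sub>i\<close> are the identity. The latter is phrased through an arbitrary \<open>E\<close> that absorbs all \<open>p\<^sub>i\<close>, which saves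
  the formation of a noncommutative product of the \<open>p\<^sub>i\<close>.
\<close>

lemma sos_commuting_projections:
  fixes p :: "'i \<Rightarrow> 'a group_algebra"
  assumes "finite I"
    and proj: "\<And>i. i \<in> I \<Longrightarrow> p i \<in> sym_alg N" "\<And>i. i \<in> I \<Longrightarrow> star (p i) = p i"
      "\<And>i. i \<in> I \<Longrightarrow> p i * p i = p i"
    and comm: "\<And>i j. i \<in> I \<Longrightarrow> j \<in> I \<Longrightarrow> p i * p j = p j * p i"
    and "\<And>i. i \<in> I \<Longrightarrow> p i * y = y * p i"
    and "\<And>i. i \<in> I \<Longrightarrow> sos N ((1 - p i) * y)"
    and "\<And>E. E \<in> sym_alg N \<Longrightarrow> (\<And>i. i \<in> I \<Longrightarrow> E * p i = E) \<Longrightarrow> sos N (E * y * star E)"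
  shows "sos N y"
  using assms
proof (induction I arbitrary: y rule: finite_induct)
  case empty
  show ?case using empty(7)[of 1] by (simp add: sym_alg_one star_simps)
next
  case (insert k I)
  note alg = insert.prems(1) and st = insert.prems(2) and idem = insert.prems(3)
    and comm = insert.prems(4) and yc = insert.prems(5) and sq = insert.prems(6)
    and sector = insert.prems(7)
  have "sos N (p k * y * p k)"
  proof (rule insert.IH)
    fix i assume i: "i \<in> I"
    show "p i * (p k * y * p k) = p k * y * p k * p i"
      using i by (intro commute_mult comm yc) auto
    have "(1 - p i) * p k = p k * (1 - p i)"
      using comm[of i k] i by (simp add: left_diff_distrib right_diff_distrib)
    then have "((1 - p i) * p k) * (y * p k) = (p k * (1 - p i)) * (y * p k)"
      by (rule arg_cong)
    then have "(1 - p i) * (p k * y * p k) = p k * ((1 - p i) * y) * star (p k)"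
      using st[of k] by (simp add: mult.assoc)
    then show "sos N ((1 - p i) * (p k * y * p k))"
      using sos_conj[OF sq[of i] alg[of k]] i by simp
  next
    fix E assume E: "E \<in> sym_alg N" "\<And>i. i \<in> I \<Longrightarrow> E * p i = E"
    have "sos N ((E * p k) * y * star (E * p k))"
    proof (rule sector)
      show "E * p k \<in> sym_alg N" using E(1) alg by (intro sym_alg_intros) auto
      fix i assume i: "i \<in> insert k I"
      show "E * p k * p i = E * p k"
      proof (cases "i = k")
        case True
        then show ?thesis using idem[of k] by (simp add: mult.assoc)
      next
        case False
        then have "E * p k * p i = (E * p i) * p k"
          using comm[of k i] i by (simp add: mult.assoc)
        then show ?thesis using E(2) False i by simp
      qed
    qed
    then show "sos N (E * (p k * y * p k) * star E)"
      using st[of k] by (simp add: star_simps mult.assoc)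
  qed (use insert.prems in auto)
  moreover have "y = p k * y * p k + (1 - p k) * y"
    using projection_absorb[OF idem[of k] yc[of k]] by (simp add: left_diff_distrib)
  ultimately show ?case
    using sq[of k] sos_add[of N "p k * y * p k" "(1 - p k) * y"] by simp
qed

lemma commute_scaleR_sum:
  fixes p :: "'b::real_algebra_1"
  assumes "\<And>i. i \<in> I \<Longrightarrow> p * f i = f i * p"
  shows "p * (\<Sum>i\<in>I. r i *\<^sub>R f i) = (\<Sum>i\<in>I. r i *\<^sub>R f i) * p"
  using assms by (simp add: sum_distrib_left sum_distrib_right)

locale blocks =
  fixes A :: "'i \<Rightarrow> 'a set" and N :: "'a set" and z :: 'a
  assumes z_in: "z \<in> N"
begin

definition block_system :: "'i set \<Rightarrow> bool" where
  "block_system I \<longleftrightarrow> finite I \<and> disjoint_family_on A I \<and> (\<forall>i\<in>I. finite (A i) \<and> A i \<subseteq> N \<and> z \<notin> A i)"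

definition spokes :: "'i \<Rightarrow> 'a group_algebra" where
  "spokes i = (\<Sum>a\<in>A i. link z a)"

text \<open>
  For the inequality to be shown, \<open>center\<close> is the part of \<open>\<Sum>\<^sub>j c\<^sub>j (\<alpha>\<^sub>A\<^sub>j\<^sub>\<union>\<^sub>z - \<alpha>\<^sub>A\<^sub>j)\<close> that lives where the
  \<open>e\<^sub>j\<close> are the identity, and \<open>merge\<close> measures how far vectors invariant under two blocks are from being
  invariant under the symmetric group of their union.
\<close>

definition center :: "('i \<Rightarrow> real) \<Rightarrow> 'i set \<Rightarrow> 'a group_algebra" where
  "center c I = (\<Sum>i\<in>I. c i *\<^sub>R (avg (A i) * spokes i))"

definition merge :: "('i \<Rightarrow> real) \<Rightarrow> 'i set \<Rightarrow> 'a group_algebra" where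
  "merge c I = (\<Sum>i\<in>I. \<Sum>j\<in>I. (c i * c j * real (card (A i) + card (A j))) *\<^sub>R
     (avg (A i) * avg (A j) - avg (A i \<union> A j)))"

definition weight :: "('i \<Rightarrow> real) \<Rightarrow> 'i set \<Rightarrow> real" where
  "weight c I = (\<Sum>i\<in>I. c i * real (card (A i)))"

context
  fixes I :: "'i set"
  assumes sys: "block_system I"
begin

lemma fin: "finite I" "i \<in> I \<Longrightarrow> finite (A i)"
  using sys by (auto simp: block_system_def)

lemma sub: "i \<in> I \<Longrightarrow> A i \<subseteq> N" "i \<in> I \<Longrightarrow> z \<notin> A i"
  using sys by (auto simp: block_system_def)

lemma disj: "i \<in> I \<Longrightarrow> j \<in> I \<Longrightarrow> i \<noteq> j \<Longrightarrow> A i \<inter> A j = {}"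
  using sys by (auto simp: block_system_def disjoint_family_on_def)

lemma avg_avg: "i \<in> I \<Longrightarrow> avg (A i) * avg (A i) = avg (A i)"
  by (simp add: avg_mult fin)

lemma avg_comm: "i \<in> I \<Longrightarrow> j \<in> I \<Longrightarrow> avg (A i) * avg (A j) = avg (A j) * avg (A i)"
  using disj[of i j] by (cases "i = j") (auto intro: avg_commute_disjoint)

lemma avg_union_absorb:
  assumes "i \<in> I" "j \<in> I"
  shows "avg (A i) * avg (A i \<union> A j) = avg (A i \<union> A j)"
    "avg (A j) * avg (A i \<union> A j) = avg (A i \<union> A j)"
  by (rule avg_mult; use assms fin in auto)+

lemma avg_union_comm:
  assumes "i \<in> I" "j \<in> I" "k \<in> I"
  shows "avg (A k) * avg (A i \<union> A j) = avg (A i \<union> A j) * avg (A k)"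
proof (cases "k = i \<or> k = j")
  case True
  then show ?thesis
    using assms fin by (intro avg_commute_nested[symmetric]) auto
next
  case False
  then show ?thesis
    using assms disj[of k i] disj[of k j] by (intro avg_commute_disjoint) auto
qed

lemma avg_spokes_comm:
  assumes "i \<in> I" "k \<in> I"
  shows "avg (A k) * spokes i = spokes i * avg (A k)"
proof (cases "i = k")
  case True
  then show ?thesis
    unfolding spokes_def using avg_commute_spokes[of z "A k"] sub assms by simp
next
  case False
  have "avg (A k) * link z a = link z a * avg (A k)" if "a \<in> A i" for a
    using that disj[OF assms False] sub assms by (intro avg_commute_link[symmetric]) auto
  then show ?thesis
    by (simp add: spokes_def sum_distrib_left sum_distrib_right)
qed

lemma avg_center_comm:
  assumes "k \<in> I" "J \<subseteq> I"
  shows "avg (A k) * center c J = center c J * avg (A k)"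
  unfolding center_def
proof (rule commute_scaleR_sum)
  fix i assume "i \<in> J"
  then have i: "i \<in> I" using assms by auto
  show "avg (A k) * (avg (A i) * spokes i) = (avg (A i) * spokes i) * avg (A k)"
    by (rule commute_mult[OF avg_comm[OF assms(1) i] avg_spokes_comm[OF i assms(1)]])
qed

lemma avg_merge_comm:
  assumes "k \<in> I" "J \<subseteq> I"
  shows "avg (A k) * merge c J = merge c J * avg (A k)"
  unfolding merge_def sum.cartesian_product case_prod_beta
proof (rule commute_scaleR_sum)
  fix ij assume ij: "ij \<in> J \<times> J"
  define i j where "i = fst ij" and "j = snd ij"
  have i: "i \<in> I" and j: "j \<in> I" using ij assms by (auto simp: i_def j_def)
  have "avg (A k) * (avg (A i) * avg (A j)) = (avg (A i) * avg (A j)) * avg (A k)"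
    by (rule commute_mult[OF avg_comm[OF assms(1) i] avg_comm[OF assms(1) j]])
  then show "avg (A k) * (avg (A (fst ij)) * avg (A (snd ij)) - avg (A (fst ij) \<union> A (snd ij)))
     = (avg (A (fst ij)) * avg (A (snd ij)) - avg (A (fst ij) \<union> A (snd ij))) * avg (A k)"
    using avg_union_comm[OF i j assms(1)]
    by (simp add: left_diff_distrib right_diff_distrib flip: i_def j_def)
qed

lemma sos_center:
  assumes "\<And>i. i \<in> I \<Longrightarrow> 0 \<le> c i"
  shows "sos N (center c I)"
  unfolding center_def
proof (intro sos_sum sos_scaleR assms)
  fix i assume i: "i \<in> I"
  have "sos N (spokes i)"
    unfolding spokes_def using sub(1)[OF i] z_in by (intro sos_sum sos_link) auto
  then have "sos N (avg (A i) * spokes i * star (avg (A i)))"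
    using sub(1)[OF i] by (intro sos_conj sym_alg_avg)
  also have "avg (A i) * spokes i * star (avg (A i)) = avg (A i) * spokes i"
    using projection_absorb[OF avg_avg[OF i] avg_spokes_comm[OF i i]] by (simp add: star_avg)
  finally show "sos N (avg (A i) * spokes i)" .
qed

text \<open>
  After compression by \<open>E\<close>, all averages over single blocks become the identity. The octopus inequality with weight
  \<open>c\<^sub>i\<close> on every leaf in \<open>A\<^sub>i\<close> bounds the first term below by
  the sum of all \<open>1 - (a b)\<close> weighted by \<open>c\<^sub>i c\<^sub>j\<close> for \<open>a \<in> A\<^sub>i\<close> and \<open>b \<in> A\<^sub>j\<close>. Transpositions within
  a block become the identity, so those between \<open>A\<^sub>i\<close> and \<open>A\<^sub>j\<close> can be completed to the complete graph
  on \<open>A\<^sub>i \<union> A\<^sub>j\<close>, whose spectral gap is known.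
\<close>

lemma sos_sector:
  assumes c: "\<And>i. i \<in> I \<Longrightarrow> 0 \<le> c i"
    and E: "E \<in> sym_alg N" "\<And>i. i \<in> I \<Longrightarrow> E * avg (A i) = E"
  shows "sos N (E * ((2 * weight c I) *\<^sub>R center c I - merge c I) * star E)"
proof -
  define cross where "cross i j = (\<Sum>a\<in>A i. \<Sum>b\<in>A j. link a b)" for i j
  define w where "w i j = real (card (A i) + card (A j))" for i j
  \<comment> \<open>The blocks are disjoint, so \<open>x a = c i\<close> for \<open>a \<in> A i\<close>.\<close>
  define x where "x a = (\<Sum>i\<in>I. if a \<in> A i then c i else 0)" for a
  have x: "x a = c i" if "i \<in> I" "a \<in> A i" for i a
  proof -
    have "(if a \<in> A j then c j else 0) = (if j = i then c i else 0)" if "j \<in> I" for j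
      using disj[OF \<open>i \<in> I\<close> that] \<open>a \<in> A i\<close> by auto
    then show ?thesis using fin(1) that(1) by (simp add: x_def)
  qed
  have union: "(\<Sum>a\<in>\<Union> (A ` I). f a) = (\<Sum>i\<in>I. \<Sum>a\<in>A i. f a)" for f :: "'a \<Rightarrow> 'b::comm_monoid_add"
    using fin disj by (intro sum.UNION_disjoint) auto
  have "sos N ((2 * (\<Sum>a\<in>\<Union> (A ` I). x a)) *\<^sub>R (\<Sum>a\<in>\<Union> (A ` I). x a *\<^sub>R link z a)
     - (\<Sum>a\<in>\<Union> (A ` I). \<Sum>b\<in>\<Union> (A ` I). (x a * x b) *\<^sub>R link a b))"
  proof (rule octopus)
    show "finite (\<Union> (A ` I))" "\<Union> (A ` I) \<subseteq> N" "z \<notin> \<Union> (A ` I)" "z \<in> N"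
      using fin sub z_in by auto
    show "0 \<le> x a" for a
      unfolding x_def by (intro sum_nonneg) (use c in auto)
  qed
  moreover have "(\<Sum>a\<in>\<Union> (A ` I). x a) = weight c I"
    unfolding union weight_def by (intro sum.cong refl) (simp add: x)
  moreover have "(\<Sum>a\<in>\<Union> (A ` I). x a *\<^sub>R link z a) = (\<Sum>i\<in>I. c i *\<^sub>R spokes i)"
    unfolding union spokes_def scaleR_sum_right by (intro sum.cong refl) (simp add: x)
  moreover have "(\<Sum>a\<in>\<Union> (A ` I). \<Sum>b\<in>\<Union> (A ` I). (x a * x b) *\<^sub>R link a b)
      = (\<Sum>i\<in>I. \<Sum>j\<in>I. (c i * c j) *\<^sub>R cross i j)"
  proof -
    have "(\<Sum>a\<in>\<Union> (A ` I). \<Sum>b\<in>\<Union> (A ` I). (x a * x b) *\<^sub>R link a b)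
      = (\<Sum>i\<in>I. \<Sum>a\<in>A i. \<Sum>j\<in>I. \<Sum>b\<in>A j. (c i * c j) *\<^sub>R link a b)"
      unfolding union by (intro sum.cong refl) (simp add: x)
    also have "\<dots> = (\<Sum>i\<in>I. \<Sum>j\<in>I. (c i * c j) *\<^sub>R cross i j)"
      unfolding cross_def scaleR_sum_right by (intro sum.cong refl sum.swap)
    finally show ?thesis .
  qed
  ultimately have oct: "sos N ((2 * weight c I) *\<^sub>R (\<Sum>i\<in>I. c i *\<^sub>R spokes i)
     - (\<Sum>i\<in>I. \<Sum>j\<in>I. (c i * c j) *\<^sub>R cross i j))"
    by simp
  have E_avg: "E * (avg (A i) * v) = E * v" if "i \<in> I" for i v
    using E(2)[OF that] by (simp flip: mult.assoc)
  have E_link: "E * link a b = 0" if "i \<in> I" "a \<in> A i" "b \<in> A i" for i a b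
  proof -
    have "E * tau a b = E * (avg (A i) * tau a b)"
      by (rule E_avg[OF that(1), symmetric])
    then show ?thesis
      by (simp add: avg_tau[OF that(2,3)] E(2)[OF that(1)] link_def right_diff_distrib)
  qed
  have cross_gap: "sos N (E * (cross i j - w i j *\<^sub>R (1 - avg (A i \<union> A j))) * star E)"
    if i: "i \<in> I" and j: "j \<in> I" for i j
  proof (cases "i = j")
    case True
    have "E * cross i i = 0"
      by (simp add: cross_def sum_distrib_left E_link[OF i])
    moreover have "E * avg (A i) = E" using E(2)[OF i] .
    ultimately have "E * (cross i j - w i j *\<^sub>R (1 - avg (A i \<union> A j))) = 0"
      using True by (simp add: right_diff_distrib)
    then show ?thesis by (simp add: sos_zero)
  next
    case False
    have d: "A i \<inter> A j = {}" by (rule disj[OF i j False])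
    define L where "L = (\<Sum>a\<in>A i \<union> A j. \<Sum>b\<in>A i \<union> A j. link a b)"
    have gap: "sos N (L - (2 * w i j) *\<^sub>R (1 - avg (A i \<union> A j)))"
      using complete_graph_gap[of "A i \<union> A j" N] fin sub i j d
      by (simp add: L_def w_def card_Un_disjoint)
    have "cross j i = cross i j"
      unfolding cross_def by (subst sum.swap) (simp add: link_sym)
    then have "L = cross i i + cross j j + 2 *\<^sub>R cross i j"
      using fin i j d by (simp add: L_def cross_def sum.union_disjoint sum.distrib scaleR_2 add_ac)
    moreover have "E * cross i i = 0" "E * cross j j = 0"
      by (simp_all add: cross_def sum_distrib_left E_link[OF i] E_link[OF j])
    ultimately have "E * (L - (2 * w i j) *\<^sub>R (1 - avg (A i \<union> A j)))
      = 2 *\<^sub>R (E * (cross i j - w i j *\<^sub>R (1 - avg (A i \<union> A j))))"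
      by (simp add: right_diff_distrib distrib_left scaleR_diff_right)
    then show ?thesis
      using sos_conj[OF gap E(1)] by (simp add: sos_scaleR_iff)
  qed
  have "E * ((2 * weight c I) *\<^sub>R center c I - merge c I) * star E
    = E * ((2 * weight c I) *\<^sub>R (\<Sum>i\<in>I. c i *\<^sub>R spokes i)
       - (\<Sum>i\<in>I. \<Sum>j\<in>I. (c i * c j * w i j) *\<^sub>R (1 - avg (A i \<union> A j)))) * star E"
  proof -
    have "E * center c I = E * (\<Sum>i\<in>I. c i *\<^sub>R spokes i)"
      by (simp add: center_def sum_distrib_left E_avg cong: sum.cong)
    moreover have "E * merge c I = E * (\<Sum>i\<in>I. \<Sum>j\<in>I. (c i * c j * w i j) *\<^sub>R (1 - avg (A i \<union> A j)))"
      by (simp add: merge_def w_def sum_distrib_left right_diff_distrib E_avg E(2) cong: sum.cong)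
    ultimately show ?thesis by (simp add: right_diff_distrib)
  qed
  also have "\<dots> = E * ((2 * weight c I) *\<^sub>R (\<Sum>i\<in>I. c i *\<^sub>R spokes i)
       - (\<Sum>i\<in>I. \<Sum>j\<in>I. (c i * c j) *\<^sub>R cross i j)) * star E
     + (\<Sum>i\<in>I. \<Sum>j\<in>I. (c i * c j) *\<^sub>R (E * (cross i j - w i j *\<^sub>R (1 - avg (A i \<union> A j))) * star E))"
    by (simp add: right_diff_distrib left_diff_distrib sum_distrib_left sum_distrib_right
        scaleR_diff_right sum_subtractf mult.assoc)
  finally show ?thesis
    using c by (auto intro!: sos_add sos_conj[OF oct E(1)] sos_sum sos_scaleR cross_gap)
qed

end

end

context blocks
begin

text \<open>
  Where \<open>e\<^sub>k = 0\<close>, every term of \<open>center\<close> and \<open>merge\<close> that involves block \<open>k\<close> vanishes, and what remains is the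
  inequality for the other blocks plus a positive multiple of their \<open>center\<close>, as block \<open>k\<close> still
  contributes to the weight.
\<close>

theorem sos_center_merge:
  assumes "block_system I" "\<And>i. i \<in> I \<Longrightarrow> 0 \<le> c i"
  shows "sos N ((2 * weight c I) *\<^sub>R center c I - merge c I)"
proof -
  have "finite I" using assms(1) by (rule fin)
  then show ?thesis using assms
  proof (induction I rule: finite_psubset_induct)
    case (psubset I)
    note sys = \<open>block_system I\<close> and c = psubset.prems(2)
    have main: "sos N ((1 - avg (A k)) * ((2 * weight c I) *\<^sub>R center c I - merge c I))"
      if k: "k \<in> I" for k
    proof -
      define J where "J = I - {k}"
      define f where "f = 1 - avg (A k)"
      define r where "r = 2 * (c k * real (card (A k)))"
      define Y where "Y = (2 * weight c J) *\<^sub>R center c J - merge c J"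
      have JI: "J \<subseteq> I" by (auto simp: J_def)
      have sysJ: "block_system J"
        using sys by (auto simp: block_system_def J_def disjoint_family_on_def)
      have "sos N Y"
        unfolding Y_def using k c JI sysJ by (intro psubset.IH) (auto simp: J_def)
      moreover have "sos N (r *\<^sub>R center c J)"
        using c k JI sysJ by (intro sos_scaleR sos_center) (auto simp: r_def)
      ultimately have sosY: "sos N (Y + r *\<^sub>R center c J)"
        by (rule sos_add)
      have kill: "f * (avg (A k) * x) = 0" for x
        using avg_avg[OF sys k] by (simp add: f_def left_diff_distrib flip: mult.assoc)
      have kill_pair: "f * (avg (A i) * avg (A j) - avg (A i \<union> A j)) = 0"
        if "i \<in> I" "j \<in> I" "i = k \<or> j = k" for i j
      proof -
        have "f * (avg (A i) * avg (A j)) = 0"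
          using that kill avg_comm[OF sys that(1,2)] by metis
        moreover have "f * avg (A i \<union> A j) = 0"
          using that(3) avg_union_absorb[OF sys that(1,2)] by (auto simp: f_def left_diff_distrib)
        ultimately show ?thesis by (simp add: right_diff_distrib)
      qed
      have "center c I = c k *\<^sub>R (avg (A k) * spokes k) + center c J"
        unfolding center_def J_def by (rule sum.remove[OF fin(1)[OF sys] k])
      then have f_center: "f * center c I = f * center c J"
        by (simp add: distrib_left kill)
      have "f * merge c I = (\<Sum>i\<in>I. \<Sum>j\<in>I. (c i * c j * real (card (A i) + card (A j))) *\<^sub>R
          (f * (avg (A i) * avg (A j) - avg (A i \<union> A j))))"
        by (simp add: merge_def sum_distrib_left)
      also have "\<dots> = (\<Sum>i\<in>J. \<Sum>j\<in>J. (c i * c j * real (card (A i) + card (A j))) *\<^sub>R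
          (f * (avg (A i) * avg (A j) - avg (A i \<union> A j))))"
      proof (rule sum.mono_neutral_cong_right)
        show "finite I" "J \<subseteq> I" using fin(1)[OF sys] JI .
        show "\<forall>i\<in>I - J. (\<Sum>j\<in>I. (c i * c j * real (card (A i) + card (A j))) *\<^sub>R
          (f * (avg (A i) * avg (A j) - avg (A i \<union> A j)))) = 0"
          by (auto simp: J_def kill_pair intro!: sum.neutral)
        fix i assume "i \<in> J"
        then show "(\<Sum>j\<in>I. (c i * c j * real (card (A i) + card (A j))) *\<^sub>R
          (f * (avg (A i) * avg (A j) - avg (A i \<union> A j)))) =
          (\<Sum>j\<in>J. (c i * c j * real (card (A i) + card (A j))) *\<^sub>R
          (f * (avg (A i) * avg (A j) - avg (A i \<union> A j))))"
          using fin(1)[OF sys] JI by (intro sum.mono_neutral_right) (auto simp: J_def kill_pair)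
      qed
      also have "\<dots> = f * merge c J"
        by (simp add: merge_def sum_distrib_left)
      finally have f_merge: "f * merge c I = f * merge c J" .
      have "weight c I = c k * real (card (A k)) + weight c J"
        unfolding weight_def J_def by (rule sum.remove[OF fin(1)[OF sys] k])
      then have w: "2 * weight c I = r + 2 * weight c J" by (simp add: r_def)
      have eq: "f * ((2 * weight c I) *\<^sub>R center c I - merge c I) = f * (Y + r *\<^sub>R center c J)"
        unfolding w Y_def by (simp add: right_diff_distrib distrib_left f_center f_merge scaleR_add_left)
      have "avg (A k) * (Y + r *\<^sub>R center c J) = (Y + r *\<^sub>R center c J) * avg (A k)"
        using avg_center_comm[OF sys k JI, of c] avg_merge_comm[OF sys k JI, of c]
        by (simp add: Y_def left_diff_distrib right_diff_distrib distrib_left distrib_right)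
      then have "f * (Y + r *\<^sub>R center c J) = (Y + r *\<^sub>R center c J) * f"
        by (simp only: f_def left_diff_distrib right_diff_distrib mult_1_left mult_1_right)
      moreover have "f * f = f"
        unfolding f_def by (rule one_minus_avg_idem[OF fin(2)[OF sys k]])
      moreover have "f \<in> sym_alg N" "star f = f"
        using sub(1)[OF sys k] by (auto simp: f_def star_simps star_avg intro!: sym_alg_intros sym_alg_avg)
      ultimately have "sos N (f * (Y + r *\<^sub>R center c J))"
        using sos_conj[OF sosY, of f] projection_absorb[of f "Y + r *\<^sub>R center c J"] by simp
      then show ?thesis
        unfolding eq[symmetric] by (simp only: f_def)
    qed
    show ?case
    proof (rule sos_commuting_projections[where p = "\<lambda>i. avg (A i)" and I = I])
      show "finite I" by (rule fin(1)[OF sys])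
      fix i assume i: "i \<in> I"
      show "avg (A i) \<in> sym_alg N" by (rule sym_alg_avg[OF sub(1)[OF sys i]])
      show "star (avg (A i)) = avg (A i)" by (rule star_avg)
      show "avg (A i) * avg (A i) = avg (A i)" by (rule avg_avg[OF sys i])
      show "avg (A i) * ((2 * weight c I) *\<^sub>R center c I - merge c I)
        = ((2 * weight c I) *\<^sub>R center c I - merge c I) * avg (A i)"
        using avg_center_comm[OF sys i subset_refl, of c] avg_merge_comm[OF sys i subset_refl, of c]
        by (simp add: left_diff_distrib right_diff_distrib)
      show "sos N ((1 - avg (A i)) * ((2 * weight c I) *\<^sub>R center c I - merge c I))"
        by (rule main[OF i])
      fix j assume j: "j \<in> I"
      show "avg (A i) * avg (A j) = avg (A j) * avg (A i)" by (rule avg_comm[OF sys i j])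
    next
      fix E assume "E \<in> sym_alg N" "\<And>i. i \<in> I \<Longrightarrow> E * avg (A i) = E"
      then show "sos N (E * ((2 * weight c I) *\<^sub>R center c I - merge c I) * star E)"
        by (intro sos_sector[OF sys] c)
    qed
  qed
qed

end

definition alpha_elt :: "'a set \<Rightarrow> 'a group_algebra" where
  "alpha_elt A = real (card A) *\<^sub>R (1 - avg A)"

lemma alpha_elt_insert:
  assumes "finite A" "z \<notin> A"
  shows "alpha_elt (insert z A) - alpha_elt A = (1 - avg A) + avg A * (\<Sum>a\<in>A. link z a)"
proof -
  have "alpha_elt (insert z A) = real (Suc (card A)) *\<^sub>R (1 - avg (insert z A))"
    using assms by (simp add: alpha_elt_def)
  also have "\<dots> = real (Suc (card A)) *\<^sub>R (1 - avg A) + avg A * (\<Sum>a\<in>A. link z a)"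
    by (simp only: avg_insert[OF assms] avg_commute_spokes[OF assms(2)])
  also have "real (Suc (card A)) *\<^sub>R (1 - avg A) = (1 - avg A) + alpha_elt A"
    by (simp only: alpha_elt_def of_nat_Suc scaleR_add_left scaleR_one)
  finally show ?thesis by simp
qed

lemma sum_pairs_less:
  fixes h :: "nat \<Rightarrow> nat \<Rightarrow> 'b::real_vector"
  assumes "\<And>i j. h i j = h j i"
  shows "(\<Sum>i=1..t. \<Sum>j=1..t. h i j) = 2 *\<^sub>R (\<Sum>i=1..t. \<Sum>j=i+1..t. h i j) + (\<Sum>i=1..t. h i i)"
proof (induction t)
  case (Suc t)
  define C where "C = (\<Sum>i=1..t. h i (Suc t))"
  have row: "(\<Sum>j=1..t. h (Suc t) j) = C"
    unfolding C_def by (rule sum.cong[OF refl assms])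
  have "(\<Sum>i=1..Suc t. \<Sum>j=i+1..Suc t. h i j) = (\<Sum>i=1..t. \<Sum>j=i+1..Suc t. h i j)"
    by simp
  also have "\<dots> = (\<Sum>i=1..t. (\<Sum>j=i+1..t. h i j) + h i (Suc t))"
    by (rule sum.cong) auto
  finally have upper: "(\<Sum>i=1..Suc t. \<Sum>j=i+1..Suc t. h i j) = (\<Sum>i=1..t. \<Sum>j=i+1..t. h i j) + C"
    by (simp only: sum.distrib C_def)
  have "(\<Sum>i=1..Suc t. \<Sum>j=1..Suc t. h i j)
      = (\<Sum>i=1..t. (\<Sum>j=1..t. h i j) + h i (Suc t)) + ((\<Sum>j=1..t. h (Suc t) j) + h (Suc t) (Suc t))"
    by simp
  also have "\<dots> = (\<Sum>i=1..t. \<Sum>j=1..t. h i j) + (C + C + h (Suc t) (Suc t))"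
    by (simp only: row sum.distrib C_def add_ac)
  also have "\<dots> = 2 *\<^sub>R ((\<Sum>i=1..t. \<Sum>j=i+1..t. h i j) + C) + ((\<Sum>i=1..t. h i i) + h (Suc t) (Suc t))"
    unfolding Suc by (simp only: scaleR_add_right scaleR_2 add_ac)
  finally show ?case
    unfolding upper by simp
qed simp

text \<open>
  Let \<open>f\<^sub>i = 1 - e\<^sub>i\<close>. Using \<open>f\<^sub>i + f\<^sub>j - 1 + e\<^sub>i e\<^sub>j = f\<^sub>i f\<^sub>j\<close>, twice the difference of the two sides is the
  element of the previous theorem plus \<open>\<Sum> c\<^sub>i c\<^sub>j (|A\<^sub>i| + |A\<^sub>j|) f\<^sub>i f\<^sub>j\<close> over the ordered pairs \<open>i \<noteq> j\<close>, and
  products of commuting projections are projections.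
\<close>

theorem sos_block_octopus:
  fixes A :: "nat \<Rightarrow> 'a set" and c :: "nat \<Rightarrow> real"
  assumes "z \<in> N" "disjoint_family_on A {1..t}"
    and A: "\<And>i. i \<in> {1..t} \<Longrightarrow> finite (A i) \<and> A i \<subseteq> N \<and> z \<notin> A i"
    and c: "\<And>i. i \<in> {1..t} \<Longrightarrow> 0 \<le> c i"
  shows "sos N ((\<Sum>i=1..t. c i * real (card (A i))) *\<^sub>R
       (\<Sum>j=1..t. c j *\<^sub>R (alpha_elt (insert z (A j)) - alpha_elt (A j)))
     - ((\<Sum>i=1..t. (c i)\<^sup>2 *\<^sub>R alpha_elt (A i)) +
        (\<Sum>i=1..t. \<Sum>j=i+1..t. (c i * c j) *\<^sub>R
           (alpha_elt (A i \<union> A j) - alpha_elt (A i) - alpha_elt (A j)))))" (is "sos N ?X")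
proof -
  interpret blocks A N z by unfold_locales fact
  let ?I = "{1..t}"
  have sys: "block_system ?I" using assms by (simp add: block_system_def)
  define f where "f i = 1 - avg (A i)" for i
  define a where "a i = real (card (A i))" for i
  define h where "h i j = (c i * c j) *\<^sub>R (alpha_elt (A i \<union> A j) - alpha_elt (A i) - alpha_elt (A j))" for i j
  define R where "R = (\<Sum>i\<in>?I. \<Sum>j\<in>?I. (c i * c j * (a i + a j)) *\<^sub>R (if i = j then 0 else f i * f j))"
  have sos_f: "sos N (f i)" and alg_f: "f i \<in> sym_alg N" and star_f: "star (f i) = f i"
    and idem_f: "f i * f i = f i" if "i \<in> ?I" for i
  proof -
    show 1: "f i \<in> sym_alg N" "star (f i) = f i" "f i * f i = f i"
      unfolding f_def using A[OF that]
      by (auto simp: star_simps star_avg one_minus_avg_idem intro!: sym_alg_intros sym_alg_avg)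
    show "sos N (f i)"
      by (rule sos_scaled_projection[where r = 1]) (use 1 in auto)
  qed
  have "sos N (f i * f j)" if "i \<in> ?I" "j \<in> ?I" for i j
  proof -
    have "f i * f j = f j * f i"
      using avg_comm[OF sys that] by (simp add: f_def algebra_simps)
    then have "f i * f j = f i * f j * star (f i)"
      using projection_absorb[OF idem_f[OF that(1)]] by (simp add: star_f[OF that(1)])
    then show ?thesis
      using sos_conj[OF sos_f[OF that(2)] alg_f[OF that(1)]] by simp
  qed
  then have "sos N R"
    unfolding R_def using c by (intro sos_sum sos_scaleR) (auto simp: a_def sos_zero)
  moreover have "sos N ((2 * weight c ?I) *\<^sub>R center c ?I - merge c ?I)"
    using sys c by (rule sos_center_merge)
  ultimately have pos: "sos N ((2 * weight c ?I) *\<^sub>R center c ?I - merge c ?I + R)"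
    by (rule sos_add[rotated])
  have spokes_part: "(\<Sum>j\<in>?I. c j *\<^sub>R (alpha_elt (insert z (A j)) - alpha_elt (A j)))
      = (\<Sum>j\<in>?I. c j *\<^sub>R f j) + center c ?I"
  proof -
    have "alpha_elt (insert z (A j)) - alpha_elt (A j) = f j + avg (A j) * spokes j" if "j \<in> ?I" for j
      using A[OF that] by (simp add: alpha_elt_insert f_def spokes_def)
    then show ?thesis by (simp add: center_def scaleR_add_right sum.distrib)
  qed
  have h_sym: "h i j = h j i" for i j
    by (simp add: h_def Un_commute algebra_simps)
  have f_part: "(2 * weight c ?I) *\<^sub>R (\<Sum>j\<in>?I. c j *\<^sub>R f j)
      = (\<Sum>i\<in>?I. \<Sum>j\<in>?I. (c i * c j) *\<^sub>R (a i *\<^sub>R f j + a j *\<^sub>R f i))"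
  proof -
    have 1: "weight c ?I *\<^sub>R (\<Sum>j\<in>?I. c j *\<^sub>R f j) = (\<Sum>i\<in>?I. \<Sum>j\<in>?I. (c i * c j * a i) *\<^sub>R f j)"
      unfolding weight_def scaleR_sum_left by (simp add: a_def scaleR_sum_right mult_ac)
    have 2: "(\<Sum>i\<in>?I. \<Sum>j\<in>?I. (c i * c j * a i) *\<^sub>R f j) = (\<Sum>i\<in>?I. \<Sum>j\<in>?I. (c i * c j * a j) *\<^sub>R f i)"
      by (subst sum.swap) (simp add: mult_ac)
    have "(2 * weight c ?I) *\<^sub>R (\<Sum>j\<in>?I. c j *\<^sub>R f j) = weight c ?I *\<^sub>R (\<Sum>j\<in>?I. c j *\<^sub>R f j)
        + weight c ?I *\<^sub>R (\<Sum>j\<in>?I. c j *\<^sub>R f j)"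
      by (simp only: mult_2 scaleR_add_left)
    also have "\<dots> = (\<Sum>i\<in>?I. \<Sum>j\<in>?I. (c i * c j * a i) *\<^sub>R f j) + (\<Sum>i\<in>?I. \<Sum>j\<in>?I. (c i * c j * a j) *\<^sub>R f i)"
      unfolding 1 using 2 by simp
    finally show ?thesis by (simp add: scaleR_add_right sum.distrib)
  qed
  \<comment> \<open>Written as double sums, the two sides can be compared term by term.\<close>
  have diag: "(\<Sum>i\<in>?I. g i) = (\<Sum>i\<in>?I. \<Sum>j\<in>?I. if i = j then g i else 0)" for g :: "nat \<Rightarrow> 'a group_algebra"
    by simp
  have pointwise: "(c i * c j) *\<^sub>R (a i *\<^sub>R f j + a j *\<^sub>R f i)
      - (if i = j then 2 *\<^sub>R ((c i)\<^sup>2 *\<^sub>R alpha_elt (A i)) - h i i else 0) - h i j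
    = (c i * c j * (a i + a j)) *\<^sub>R (if i = j then 0 else f i * f j)
      - (c i * c j * (a i + a j)) *\<^sub>R (avg (A i) * avg (A j) - avg (A i \<union> A j))"
    if "i \<in> ?I" "j \<in> ?I" for i j
  proof (cases "i = j")
    case True
    have "a i *\<^sub>R f i = alpha_elt (A i)"
      by (simp add: a_def f_def alpha_elt_def)
    then show ?thesis
      using True avg_avg[OF sys that(1)] scaleR_add_left[of "c j * c j" "c j * c j" "alpha_elt (A j)"]
      by (simp add: power2_eq_square scaleR_2 scaleR_add_right)
  next
    case False
    then have "card (A i \<union> A j) = card (A i) + card (A j)"
      using A that disj[OF sys that] by (intro card_Un_disjoint) auto
    then have union: "alpha_elt (A i \<union> A j) = (a i + a j) *\<^sub>R (1 - avg (A i \<union> A j))"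
      by (simp add: alpha_elt_def a_def)
    have alpha_f: "alpha_elt (A k) = a k *\<^sub>R f k" for k
      by (simp add: alpha_elt_def a_def f_def)
    have "(r *\<^sub>R (1 - q) + s *\<^sub>R (1 - p)) - ((r + s) *\<^sub>R (1 - m) - r *\<^sub>R (1 - p) - s *\<^sub>R (1 - q))
        = (r + s) *\<^sub>R ((1 - p) * (1 - q)) - (r + s) *\<^sub>R (p * q - m)"
      for r s :: real and p q m :: "'a group_algebra"
      by (simp add: algebra_simps)
    then have "(a i *\<^sub>R f j + a j *\<^sub>R f i) - (alpha_elt (A i \<union> A j) - alpha_elt (A i) - alpha_elt (A j))
      = (a i + a j) *\<^sub>R (f i * f j) - (a i + a j) *\<^sub>R (avg (A i) * avg (A j) - avg (A i \<union> A j))"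
      by (simp only: union alpha_f f_def)
    from arg_cong[OF this, of "scaleR (c i * c j)"] show ?thesis
      using False by (simp only: h_def if_False scaleR_diff_right scaleR_scaleR diff_0_right)
  qed
  have "2 *\<^sub>R ?X = (2 * weight c ?I) *\<^sub>R ((\<Sum>j\<in>?I. c j *\<^sub>R f j) + center c ?I)
    - (2 *\<^sub>R (\<Sum>i\<in>?I. (c i)\<^sup>2 *\<^sub>R alpha_elt (A i)) + 2 *\<^sub>R (\<Sum>i=1..t. \<Sum>j=i+1..t. h i j))"
    unfolding spokes_part weight_def h_def by (simp add: scaleR_diff_right scaleR_add_right)
  also have "2 *\<^sub>R (\<Sum>i=1..t. \<Sum>j=i+1..t. h i j) = (\<Sum>i\<in>?I. \<Sum>j\<in>?I. h i j) - (\<Sum>i\<in>?I. h i i)"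
    using sum_pairs_less[of h t, OF h_sym] by simp
  also have "(2 * weight c ?I) *\<^sub>R ((\<Sum>j\<in>?I. c j *\<^sub>R f j) + center c ?I)
    - (2 *\<^sub>R (\<Sum>i\<in>?I. (c i)\<^sup>2 *\<^sub>R alpha_elt (A i)) + ((\<Sum>i\<in>?I. \<Sum>j\<in>?I. h i j) - (\<Sum>i\<in>?I. h i i)))
    = (2 * weight c ?I) *\<^sub>R center c ?I +
      ((2 * weight c ?I) *\<^sub>R (\<Sum>j\<in>?I. c j *\<^sub>R f j)
        - (\<Sum>i\<in>?I. 2 *\<^sub>R ((c i)\<^sup>2 *\<^sub>R alpha_elt (A i)) - h i i) - (\<Sum>i\<in>?I. \<Sum>j\<in>?I. h i j))"
    by (simp add: scaleR_add_right scaleR_sum_right sum_subtractf)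
  also have "(2 * weight c ?I) *\<^sub>R (\<Sum>j\<in>?I. c j *\<^sub>R f j)
        - (\<Sum>i\<in>?I. 2 *\<^sub>R ((c i)\<^sup>2 *\<^sub>R alpha_elt (A i)) - h i i) - (\<Sum>i\<in>?I. \<Sum>j\<in>?I. h i j)
     = (\<Sum>i\<in>?I. \<Sum>j\<in>?I. (c i * c j) *\<^sub>R (a i *\<^sub>R f j + a j *\<^sub>R f i)
      - (if i = j then 2 *\<^sub>R ((c i)\<^sup>2 *\<^sub>R alpha_elt (A i)) - h i i else 0) - h i j)"
    unfolding f_part diag[of "\<lambda>i. 2 *\<^sub>R ((c i)\<^sup>2 *\<^sub>R alpha_elt (A i)) - h i i"]
    by (simp only: sum_subtractf)
  also have "\<dots> = (\<Sum>i\<in>?I. \<Sum>j\<in>?I. (c i * c j * (a i + a j)) *\<^sub>R (if i = j then 0 else f i * f j)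
      - (c i * c j * (a i + a j)) *\<^sub>R (avg (A i) * avg (A j) - avg (A i \<union> A j)))"
    by (intro sum.cong refl pointwise)
  also have "\<dots> = R - merge c ?I"
    by (simp add: R_def merge_def sum_subtractf a_def)
  finally have "2 *\<^sub>R ?X = (2 * weight c ?I) *\<^sub>R center c ?I - merge c ?I + R"
    by simp
  with pos have "sos N (2 *\<^sub>R ?X)" by simp
  then show ?thesis by (simp only: sos_scaleR_iff zero_less_numeral)
qed

section \<open>Passage to unitary representations\<close>

locale unitary_rep =
  fixes n d :: nat and \<rho> :: "(nat \<Rightarrow> nat) \<Rightarrow> complex mat"
    and ip :: "complex vec \<Rightarrow> complex vec \<Rightarrow> complex"
  assumes rep: "sym_rep n d \<rho>" and inner: "inner_product_on d ip" and inv: "sym_invariant n d \<rho> ip"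
begin

definition act :: "nat group_algebra \<Rightarrow> complex mat" where
  "act x = rep_action n d \<rho> (\<lambda>\<pi>. Poly_Mapping.lookup x (Bij \<pi>))"

text \<open>
  The matrix coefficient of the operator of \<open>x\<close>. Working with it avoids finite sums of vectors.
\<close>

definition coeff_form :: "complex vec \<Rightarrow> complex vec \<Rightarrow> nat group_algebra \<Rightarrow> complex" where
  "coeff_form u w x = (\<Sum>\<pi> | \<pi> permutes {1..n}.
     complex_of_real (Poly_Mapping.lookup x (Bij \<pi>)) * ip (\<rho> \<pi> *\<^sub>v u) w)"

lemma rho_carrier: "\<pi> permutes {1..n} \<Longrightarrow> \<rho> \<pi> \<in> carrier_mat d d"
  using rep by (simp add: sym_rep_def)

lemma rho_vec: "\<pi> permutes {1..n} \<Longrightarrow> v \<in> carrier_vec d \<Longrightarrow> \<rho> \<pi> *\<^sub>v v \<in> carrier_vec d"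
  using rho_carrier by (rule mult_mat_vec_carrier)

lemma rho_mult_vec:
  assumes "\<pi> permutes {1..n}" "\<sigma> permutes {1..n}" "v \<in> carrier_vec d"
  shows "\<rho> (\<pi> \<circ> \<sigma>) *\<^sub>v v = \<rho> \<pi> *\<^sub>v (\<rho> \<sigma> *\<^sub>v v)"
proof -
  have "\<rho> (\<pi> \<circ> \<sigma>) = \<rho> \<pi> * \<rho> \<sigma>" using rep assms by (simp add: sym_rep_def)
  then show ?thesis
    using assoc_mult_mat_vec[OF rho_carrier[OF assms(1)] rho_carrier[OF assms(2)] assms(3)] by simp
qed

lemma ip_add: "u \<in> carrier_vec d \<Longrightarrow> v \<in> carrier_vec d \<Longrightarrow> w \<in> carrier_vec d \<Longrightarrow> ip (u + v) w = ip u w + ip v w"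
  using inner unfolding inner_product_on_def by blast

lemma ip_smult: "v \<in> carrier_vec d \<Longrightarrow> w \<in> carrier_vec d \<Longrightarrow> ip (a \<cdot>\<^sub>v v) w = a * ip v w"
  using inner unfolding inner_product_on_def by blast

lemma ip_cnj: "v \<in> carrier_vec d \<Longrightarrow> w \<in> carrier_vec d \<Longrightarrow> ip w v = cnj (ip v w)"
  using inner unfolding inner_product_on_def by blast

lemma ip_pos: "v \<in> carrier_vec d \<Longrightarrow> v \<noteq> 0\<^sub>v d \<Longrightarrow> 0 < Re (ip v v)"
  using inner unfolding inner_product_on_def by blast

lemma ip_zero: "w \<in> carrier_vec d \<Longrightarrow> ip (0\<^sub>v d) w = 0"
proof -
  assume w: "w \<in> carrier_vec d"
  have "0 \<cdot>\<^sub>v 0\<^sub>v d = (0\<^sub>v d :: complex vec)" by (intro eq_vecI) auto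
  then show "ip (0\<^sub>v d) w = 0" using ip_smult[of "0\<^sub>v d" w 0] w by simp
qed

lemma ip_nonneg: "v \<in> carrier_vec d \<Longrightarrow> 0 \<le> Re (ip v v)"
  using ip_pos[of v] ip_zero[of v] by (cases "v = 0\<^sub>v d") auto

lemma ip_rho:
  assumes "\<pi> permutes {1..n}" "u \<in> carrier_vec d" "w \<in> carrier_vec d"
  shows "ip (\<rho> \<pi> *\<^sub>v u) w = ip u (\<rho> (inv_into UNIV \<pi>) *\<^sub>v w)"
proof -
  let ?\<sigma> = "inv_into UNIV \<pi>"
  have s: "?\<sigma> permutes {1..n}" using assms(1) by (rule permutes_inv)
  have "ip (\<rho> \<pi> *\<^sub>v u) w = ip (\<rho> ?\<sigma> *\<^sub>v (\<rho> \<pi> *\<^sub>v u)) (\<rho> ?\<sigma> *\<^sub>v w)"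
    using inv s rho_vec[OF assms(1,2)] assms(3) by (simp add: sym_invariant_def)
  also have "\<rho> ?\<sigma> *\<^sub>v (\<rho> \<pi> *\<^sub>v u) = \<rho> id *\<^sub>v u"
    using rho_mult_vec[OF s assms(1,2)] permutes_inv_o(2)[OF assms(1)] by simp
  also have "\<rho> id = 1\<^sub>m d" using rep by (simp add: sym_rep_def)
  finally show ?thesis using assms(2) by simp
qed

lemma act_carrier: "act x \<in> carrier_mat d d"
  by (simp add: act_def rep_action_def)

lemma act_vec: "v \<in> carrier_vec d \<Longrightarrow> act x *\<^sub>v v \<in> carrier_vec d"
  using act_carrier by (rule mult_mat_vec_carrier)

lemma ip_act:
  assumes u: "u \<in> carrier_vec d" and w: "w \<in> carrier_vec d"
  shows "ip (act x *\<^sub>v u) w = coeff_form u w x"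
proof -
  define f where "f \<pi> = complex_of_real (Poly_Mapping.lookup x (Bij \<pi>))" for \<pi>
  define M where "M S = mat d d (\<lambda>(i, j). \<Sum>\<pi>\<in>S. f \<pi> * \<rho> \<pi> $$ (i, j))" for S
  have "ip (M S *\<^sub>v u) w = (\<Sum>\<pi>\<in>S. f \<pi> * ip (\<rho> \<pi> *\<^sub>v u) w)"
    if "finite S" "S \<subseteq> {\<pi>. \<pi> permutes {1..n}}" for S
    using that
  proof (induction S rule: finite_induct)
    case empty
    have "M {} *\<^sub>v u = 0\<^sub>v d"
      using u by (intro eq_vecI) (auto simp: M_def scalar_prod_def)
    then show ?case using ip_zero[OF w] by simp
  next
    case (insert \<pi> S)
    have p: "\<pi> permutes {1..n}" using insert by auto
    have "M (insert \<pi> S) *\<^sub>v u = f \<pi> \<cdot>\<^sub>v (\<rho> \<pi> *\<^sub>v u) + M S *\<^sub>v u"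
    proof (rule eq_vecI)
      fix i assume "i < dim_vec (f \<pi> \<cdot>\<^sub>v (\<rho> \<pi> *\<^sub>v u) + M S *\<^sub>v u)"
      then have i: "i < d" by (simp add: M_def)
      show "(M (insert \<pi> S) *\<^sub>v u) $ i = (f \<pi> \<cdot>\<^sub>v (\<rho> \<pi> *\<^sub>v u) + M S *\<^sub>v u) $ i"
        using i u rho_carrier[OF p] insert(1,2)
        by (auto simp: M_def scalar_prod_def sum_distrib_left sum.distrib distrib_right mult.assoc)
    qed (simp add: M_def)
    then show ?case
      using insert u w p rho_vec[OF p u]
      by (simp add: ip_add ip_smult M_def mult_mat_vec_carrier[of _ d d])
  qed
  from this[of "{\<pi>. \<pi> permutes {1..n}}"] show ?thesis
    by (simp add: finite_permutations act_def rep_action_def coeff_form_def M_def f_def)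
qed

lemma coeff_form_zero: "coeff_form u w 0 = 0"
  by (simp add: coeff_form_def)

lemma coeff_form_add: "coeff_form u w (x + y) = coeff_form u w x + coeff_form u w y"
  by (simp add: coeff_form_def lookup_add sum.distrib distrib_right)

lemma coeff_form_scaleR: "coeff_form u w (r *\<^sub>R x) = of_real r * coeff_form u w x"
  by (simp add: coeff_form_def lookup_scaleR sum_distrib_left mult.assoc)

lemma coeff_form_sum: "coeff_form u w (\<Sum>i\<in>I. g i) = (\<Sum>i\<in>I. coeff_form u w (g i))"
  by (induction I rule: infinite_finite_induct) (simp_all add: coeff_form_zero coeff_form_add)

lemma coeff_form_perm_elt:
  assumes "\<sigma> permutes {1..n}"
  shows "coeff_form u w (perm_elt \<sigma>) = ip (\<rho> \<sigma> *\<^sub>v u) w"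
proof -
  have "coeff_form u w (perm_elt \<sigma>) = (\<Sum>\<pi> | \<pi> permutes {1..n}. if \<pi> = \<sigma> then ip (\<rho> \<sigma> *\<^sub>v u) w else 0)"
    unfolding coeff_form_def using assms
    by (intro sum.cong) (auto simp: lookup_perm_elt permutes_bij)
  then show ?thesis using assms by (simp add: finite_permutations)
qed

lemma sym_alg_expand:
  assumes "x \<in> sym_alg {1..n}"
  shows "x = (\<Sum>\<pi> | \<pi> permutes {1..n}. Poly_Mapping.lookup x (Bij \<pi>) *\<^sub>R perm_elt \<pi>)"
proof (rule poly_mapping_eqI)
  fix p :: "nat bijection"
  have "Poly_Mapping.lookup (\<Sum>\<pi> | \<pi> permutes {1..n}. Poly_Mapping.lookup x (Bij \<pi>) *\<^sub>R perm_elt \<pi>) p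
     = (\<Sum>\<pi> | \<pi> permutes {1..n}. if \<pi> = apply_bij p then Poly_Mapping.lookup x p else 0)"
    unfolding lookup_sum
  proof (rule sum.cong[OF refl])
    fix \<pi> assume "\<pi> \<in> {\<pi>. \<pi> permutes {1..n}}"
    then have "Bij \<pi> = p \<longleftrightarrow> \<pi> = apply_bij p"
      by (metis Bij_inverse apply_bij_inverse mem_Collect_eq permutes_bij)
    then show "Poly_Mapping.lookup (Poly_Mapping.lookup x (Bij \<pi>) *\<^sub>R perm_elt \<pi>) p
      = (if \<pi> = apply_bij p then Poly_Mapping.lookup x p else 0)"
      by (auto simp: lookup_scaleR perm_elt_def lookup_single when_def)
  qed
  also have "\<dots> = Poly_Mapping.lookup x p"
    using assms by (auto simp: finite_permutations sym_alg_def in_keys_iff)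
  finally show "Poly_Mapping.lookup x p
    = Poly_Mapping.lookup (\<Sum>\<pi> | \<pi> permutes {1..n}. Poly_Mapping.lookup x (Bij \<pi>) *\<^sub>R perm_elt \<pi>) p" ..
qed

lemma coeff_form_star:
  assumes "u \<in> carrier_vec d" "w \<in> carrier_vec d"
  shows "coeff_form u w (star x) = cnj (coeff_form w u x)"
proof -
  have "cnj (coeff_form w u x) = (\<Sum>\<pi> | \<pi> permutes {1..n}.
      complex_of_real (Poly_Mapping.lookup x (Bij \<pi>)) * ip (\<rho> (inv_into UNIV \<pi>) *\<^sub>v u) w)"
    unfolding coeff_form_def cnj_sum
  proof (rule sum.cong[OF refl])
    fix \<pi> assume "\<pi> \<in> {\<pi>. \<pi> permutes {1..n}}"
    then have p: "\<pi> permutes {1..n}" by simp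
    have "cnj (ip (\<rho> \<pi> *\<^sub>v w) u) = ip u (\<rho> \<pi> *\<^sub>v w)"
      by (rule ip_cnj[symmetric]) (use assms p rho_vec in auto)
    also have "\<dots> = ip (\<rho> (inv_into UNIV \<pi>) *\<^sub>v u) w"
      using ip_rho[OF permutes_inv[OF p] assms] permutes_inv_inv[OF p] by simp
    finally show "cnj (complex_of_real (Poly_Mapping.lookup x (Bij \<pi>)) * ip (\<rho> \<pi> *\<^sub>v w) u)
      = complex_of_real (Poly_Mapping.lookup x (Bij \<pi>)) * ip (\<rho> (inv_into UNIV \<pi>) *\<^sub>v u) w" by simp
  qed
  also have "\<dots> = (\<Sum>\<pi> | \<pi> permutes {1..n}.
      complex_of_real (Poly_Mapping.lookup x (Bij (inv_into UNIV \<pi>))) * ip (\<rho> \<pi> *\<^sub>v u) w)"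
    by (subst sum_permutations_inverse) (auto intro!: sum.cong simp: permutes_inv_inv)
  also have "\<dots> = coeff_form u w (star x)"
    unfolding coeff_form_def
    by (auto intro!: sum.cong simp: lookup_star uminus_bijection.abs_eq eq_onp_def permutes_bij)
  finally show ?thesis ..
qed

lemma coeff_form_mult:
  assumes "x \<in> sym_alg {1..n}" "y \<in> sym_alg {1..n}" and u: "u \<in> carrier_vec d" and w: "w \<in> carrier_vec d"
  shows "coeff_form u w (x * y) = coeff_form (act y *\<^sub>v u) w x"
proof -
  let ?P = "{\<pi>. \<pi> permutes {1..n}}"
  let ?c = "\<lambda>z \<pi>. complex_of_real (Poly_Mapping.lookup z (Bij \<pi>))"
  have "coeff_form u w (x * y) = coeff_form u w
     ((\<Sum>\<pi>\<in>?P. Poly_Mapping.lookup x (Bij \<pi>) *\<^sub>R perm_elt \<pi>) * (\<Sum>\<sigma>\<in>?P. Poly_Mapping.lookup y (Bij \<sigma>) *\<^sub>R perm_elt \<sigma>))"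
    using sym_alg_expand[OF assms(1)] sym_alg_expand[OF assms(2)] by simp
  also have "\<dots> = (\<Sum>\<pi>\<in>?P. \<Sum>\<sigma>\<in>?P. ?c x \<pi> * (?c y \<sigma> * coeff_form u w (perm_elt \<pi> * perm_elt \<sigma>)))"
    by (simp add: sum_product coeff_form_sum coeff_form_scaleR mult_ac)
  also have "\<dots> = (\<Sum>\<pi>\<in>?P. \<Sum>\<sigma>\<in>?P. ?c x \<pi> * (?c y \<sigma> * ip (\<rho> \<sigma> *\<^sub>v u) (\<rho> (inv_into UNIV \<pi>) *\<^sub>v w)))"
  proof (intro sum.cong refl arg_cong[where f = "(*) _"])
    fix \<pi> \<sigma> assume "\<pi> \<in> ?P" "\<sigma> \<in> ?P"
    then have p: "\<pi> permutes {1..n}" and s: "\<sigma> permutes {1..n}" by auto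
    have "coeff_form u w (perm_elt \<pi> * perm_elt \<sigma>) = ip (\<rho> (\<pi> \<circ> \<sigma>) *\<^sub>v u) w"
      using p s by (simp add: perm_elt_mult permutes_bij coeff_form_perm_elt permutes_compose)
    also have "\<dots> = ip (\<rho> \<sigma> *\<^sub>v u) (\<rho> (inv_into UNIV \<pi>) *\<^sub>v w)"
      using rho_mult_vec[OF p s u] ip_rho[OF p rho_vec[OF s u] w] by simp
    finally show "coeff_form u w (perm_elt \<pi> * perm_elt \<sigma>) = \<dots>" .
  qed
  also have "\<dots> = (\<Sum>\<pi>\<in>?P. ?c x \<pi> * ip (\<rho> \<pi> *\<^sub>v (act y *\<^sub>v u)) w)"
  proof (rule sum.cong[OF refl])
    fix \<pi> assume "\<pi> \<in> ?P"
    then have p: "\<pi> permutes {1..n}" by simp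
    have "ip (\<rho> \<pi> *\<^sub>v (act y *\<^sub>v u)) w = coeff_form u (\<rho> (inv_into UNIV \<pi>) *\<^sub>v w) y"
      using ip_rho[OF p act_vec[OF u] w] ip_act[OF u rho_vec[OF permutes_inv[OF p] w]] by simp
    then show "(\<Sum>\<sigma>\<in>?P. ?c x \<pi> * (?c y \<sigma> * ip (\<rho> \<sigma> *\<^sub>v u) (\<rho> (inv_into UNIV \<pi>) *\<^sub>v w)))
      = ?c x \<pi> * ip (\<rho> \<pi> *\<^sub>v (act y *\<^sub>v u)) w"
      by (simp add: coeff_form_def sum_distrib_left)
  qed
  finally show ?thesis by (simp add: coeff_form_def)
qed

lemma coeff_form_square:
  assumes "g \<in> sym_alg {1..n}" "v \<in> carrier_vec d"
  shows "coeff_form v v (star g * g) = ip (act g *\<^sub>v v) (act g *\<^sub>v v)"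
proof -
  have "coeff_form v v (star g * g) = cnj (coeff_form v (act g *\<^sub>v v) g)"
    using assms by (simp add: coeff_form_mult sym_alg_star coeff_form_star act_vec)
  also have "\<dots> = cnj (ip (act g *\<^sub>v v) (act g *\<^sub>v v))"
    using assms by (simp add: ip_act act_vec)
  also have "\<dots> = ip (act g *\<^sub>v v) (act g *\<^sub>v v)"
    using assms by (simp add: act_vec flip: ip_cnj)
  finally show ?thesis .
qed

lemma coeff_form_sos:
  assumes "sos {1..n} x" "v \<in> carrier_vec d"
  shows "0 \<le> Re (coeff_form v v x)"
  using assms(1)
proof induction
  case (sos_add_square x g)
  then show ?case
    using assms(2) by (simp add: coeff_form_add coeff_form_square ip_nonneg act_vec)
qed (simp add: coeff_form_zero)

theorem psd_operator_sos:
  assumes "sos {1..n} x"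
  shows "psd_operator d ip (act x)"
  unfolding psd_operator_def
proof safe
  have self_adjoint: "coeff_form u w x = cnj (coeff_form w u x)"
    if "u \<in> carrier_vec d" "w \<in> carrier_vec d" for u w
    using coeff_form_star[OF that, of x] sos_star[OF assms] by simp
  show "ip (act x *\<^sub>v v) w = ip v (act x *\<^sub>v w)" if v: "v \<in> carrier_vec d" and w: "w \<in> carrier_vec d" for v w
  proof -
    have "ip v (act x *\<^sub>v w) = cnj (ip (act x *\<^sub>v w) v)"
      using ip_cnj[OF act_vec[OF w] v] .
    then show ?thesis using self_adjoint[OF v w] v w by (simp add: ip_act)
  qed
  fix k assume "eigenvalue (act x) k"
  then obtain v where v: "v \<in> carrier_vec d" "v \<noteq> 0\<^sub>v d" "act x *\<^sub>v v = k \<cdot>\<^sub>v v"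
    using act_carrier[of x] by (auto simp: eigenvalue_def eigenvector_def)
  have eq: "k * ip v v = coeff_form v v x"
    using ip_act[OF v(1) v(1), of x] v by (simp add: ip_smult)
  have "Im (ip v v) = 0"
    using arg_cong[OF ip_cnj[OF v(1) v(1)], of Im] by simp
  have pos: "0 < Re (ip v v)" by (rule ip_pos[OF v(1,2)])
  have "Im (coeff_form v v x) = 0"
    using arg_cong[OF self_adjoint[OF v(1) v(1)], of Im] by simp
  then have "Im k * Re (ip v v) = 0"
    using arg_cong[OF eq, of Im] \<open>Im (ip v v) = 0\<close> by simp
  then have "Im k = 0" using pos by simp
  then show "k \<in> \<real>" by (simp add: complex_is_Real_iff)
  have "0 \<le> Re k * Re (ip v v)"
    using coeff_form_sos[OF assms v(1)] arg_cong[OF eq, of Re] \<open>Im (ip v v) = 0\<close> by simp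
  then show "0 \<le> Re k" using pos by (simp add: zero_le_mult_iff)
qed

end

section \<open>The operator inequality\<close>

lemma lookup_alpha_elt:
  assumes "finite A" "bij \<tau>"
  shows "Poly_Mapping.lookup (alpha_elt A) (Bij \<tau>) = alpha A \<tau>"
proof (cases "A = {}")
  case True
  then show ?thesis by (simp add: alpha_elt_def alpha_def)
next
  case False
  define m where "m = card A"
  have m: "0 < m" using False assms(1) by (simp add: m_def card_gt_0_iff)
  define s where "s = (\<Sum>\<pi> | \<pi> permutes A. basis_elt \<pi> \<tau>)"
  have "Poly_Mapping.lookup (\<Sum>\<pi> | \<pi> permutes A. perm_elt \<pi>) (Bij \<tau>) = s"
    by (auto simp: s_def lookup_sum lookup_perm_elt assms(2) permutes_bij basis_elt_def
        intro!: sum.cong)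
  moreover have "Poly_Mapping.lookup 1 (Bij \<tau>) = basis_elt id \<tau>"
    using lookup_perm_elt[OF bij_id assms(2)] by (simp add: basis_elt_def)
  ultimately have lookup: "Poly_Mapping.lookup (alpha_elt A) (Bij \<tau>) = real m * (basis_elt id \<tau> - s / fact m)"
    by (simp add: alpha_elt_def avg_def lookup_scaleR lookup_minus m_def)
  have alpha: "alpha A \<tau> = (fact m * basis_elt id \<tau> - s) / fact (m - 1)"
    using False card_permutations[OF refl assms(1)]
    by (simp add: alpha_def s_def m_def sum_subtractf)
  have fact: "fact m = real m * fact (m - 1)"
    using m by (simp add: fact_reduce)
  show ?thesis
    unfolding lookup alpha fact using m by (simp add: field_simps)
qed

lemma sos_mono:
  assumes "sos N x" "sym_alg N \<subseteq> sym_alg N'"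
  shows "sos N' x"
  using assms(1) by induction (use assms(2) in \<open>auto intro: sos.intros\<close>)

text \<open>
  For \<open>n = 0\<close> the point \<open>1\<close> lies outside \<open>{1..n}\<close>, but a single point has no nontrivial permutations.
\<close>

lemma sym_alg_insert_1: "sym_alg (insert 1 {1..n}) \<subseteq> sym_alg {1..n::nat}"
proof (cases "n = 0")
  case True
  have "apply_bij p permutes {}" if "apply_bij p permutes {1}" for p :: "nat bijection"
    using that by (simp add: permutes_sing)
  then show ?thesis using True by (auto simp: sym_alg_def)
next
  case False
  then show ?thesis by (simp add: insert_absorb)
qed

theorem theorem1p7:
  fixes n t :: nat and A :: "nat \<Rightarrow> nat set" and c :: "nat \<Rightarrow> real"
  assumes "\<And>i. i \<in> {1..t} \<Longrightarrow> A i \<subseteq> {2..n}"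
    and "disjoint_family_on A {1..t}"
    and "\<And>i. i \<in> {1..t} \<Longrightarrow> 0 \<le> c i"
  shows "op_geq n
    (\<lambda>\<pi>. (\<Sum>i=1..t. c i * real (card (A i))) *
          (\<Sum>j=1..t. c j * (alpha (A j \<union> {1}) \<pi> - alpha (A j) \<pi>)))
    (\<lambda>\<pi>. (\<Sum>i=1..t. (c i)\<^sup>2 * alpha (A i) \<pi>) +
          (\<Sum>i=1..t. \<Sum>j=i+1..t. c i * c j * (alpha (A i \<union> A j) \<pi> - alpha (A i) \<pi> - alpha (A j) \<pi>)))"
    (is "op_geq n ?f ?g")
proof -
  define X where "X = (\<Sum>i=1..t. c i * real (card (A i))) *\<^sub>R
       (\<Sum>j=1..t. c j *\<^sub>R (alpha_elt (insert 1 (A j)) - alpha_elt (A j)))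
     - ((\<Sum>i=1..t. (c i)\<^sup>2 *\<^sub>R alpha_elt (A i)) +
        (\<Sum>i=1..t. \<Sum>j=i+1..t. (c i * c j) *\<^sub>R
           (alpha_elt (A i \<union> A j) - alpha_elt (A i) - alpha_elt (A j))))"
  have fin: "finite (A i)" if "i \<in> {1..t}" for i
    using assms(1)[OF that] finite_subset by blast
  have "sos (insert 1 {1..n}) X"
    unfolding X_def using assms fin
    by (intro sos_block_octopus) (fastforce)+
  then have sosX: "sos {1..n} X"
    by (rule sos_mono[OF _ sym_alg_insert_1])
  have coeffs: "?f \<pi> - ?g \<pi> = Poly_Mapping.lookup X (Bij \<pi>)" if "\<pi> permutes {1..n}" for \<pi>
    using permutes_bij[OF that] fin
    by (simp add: X_def lookup_minus lookup_add lookup_scaleR lookup_sum lookup_alpha_elt)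
  show ?thesis
    unfolding op_geq_def
  proof (intro allI impI)
    fix d \<rho> ip
    assume "sym_rep n d \<rho>" "inner_product_on d ip" "sym_invariant n d \<rho> ip"
    then interpret unitary_rep n d \<rho> ip by unfold_locales
    have "rep_action n d \<rho> (\<lambda>\<pi>. ?f \<pi> - ?g \<pi>) = act X"
      unfolding act_def rep_action_def using coeffs by (auto intro!: eq_matI sum.cong)
    then show "psd_operator d ip (rep_action n d \<rho> (\<lambda>\<pi>. ?f \<pi> - ?g \<pi>))"
      using psd_operator_sos[OF sosX] by simp
  qed
qed

end
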